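(* Let $\mathbf a$ be a multisegment with $N$ segments and let $J_1=J_1(\mathbf a)$, $J_2=J_2(\mathbf a)$. Then: (1) there exist a multisegment $\mathbf a_w^{J_1,J_2}$ of parabolic type $(J_1,J_2)$ (with $w\in S_N^{J_1,J_2}$) and a sequence of integers $k_1,\dots,k_r$ such that $S(\mathbf a)\simeq S(\mathbf a_w^{J_1,J_2})_{k_r,\dots,k_1}$ as partially ordered sets; (2) there exists an element $\mathbf a'\in S(\mathbf a_w^{J_1,J_2})$ such that $$S(\mathbf a_w^{J_1,J_2})_{k_r,\dots,k_1}=\{\mathbf c\in S(\mathbf a_w^{J_1,J_2}):\mathbf c\ge\mathbf a'\}.$$
   Context: A segment is $\Delta=[i,j]=\{i,\dots,j\}$ with integers $i\le j$; $b(\Delta)=i$, $e(\Delta)=j$. A multisegment is a finite multiset of segments; empty segments are discarded; $\deg(\mathbf a)$ is the sum of the cardinalities of its segments. Two segments are linked if neither contains the other and their union is a segment. An elementary operation replaces a linked pair $\{\Delta,\Delta'\}$ by $\{\Delta\cup\Delta',\Delta\cap\Delta'\}$. Write $\mathbf b\le\mathbf a$ if $\mathbf b$ is obtained from $\mathbf a$ by a (possibly empty) series of elementary operations; $S(\mathbf a)=\{\mathbf b:\mathbf b\le\mathbf a\}$ with this order. Let $\sigma_i=(i,i+1)$ be the simple transpositions of $S_N$. If the multiset of beginnings of $\mathbf a$ is $\{k_1\le\cdots\le k_N\}$ and the multiset of ends is $\{\ell_1\le\cdots\le\ell_N\}$, then $J_2(\mathbf a)=\{\sigma_i:k_i=k_{i+1}\}$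 and $J_1(\mathbf a)=\{\sigma_i:\ell_i=\ell_{i+1}\}$. For subsets $J_1,J_2$ of simple transpositions, $S_N^{J_1,J_2}=\{w\in S_N:s_1w>w\ \forall s_1\in J_1,\ ws_2>w\ \forall s_2\in J_2\}$ (Bruhat order). Let $\mathbf a_{\mathrm{Id}}^{J_1,J_2}=\{\Delta_1,\dots,\Delta_N\}$ be a multisegment with $e(\Delta_1)\le\cdots\le e(\Delta_N)$, $e(\Delta_i)=e(\Delta_{i+1})$ iff $\sigma_i\in J_1$; $b(\Delta_1)\le\cdots\le b(\Delta_N)$, $b(\Delta_i)=b(\Delta_{i+1})$ iff $\sigma_i\in J_2$; and $b(\Delta_N)\le e(\Delta_1)$. A multisegment of parabolic type $(J_1,J_2)$ is an element of $S(\mathbf a_{\mathrm{Id}}^{J_1,J_2})$ for some such $\mathbf a_{\mathrm{Id}}^{J_1,J_2}$, and $\mathbf a_w^{J_1,J_2}=\sum_i[b(\Delta_i),e(\Delta_{w(i)})]$ for $w\in S_N^{J_1,J_2}$. Truncation: $\Delta^{(k)}=[i,j-1]$ if $\Delta=[i,j]$ with $j=k$, and $\Delta^{(k)}=\Delta$ otherwise; $\mathbf a^{(k)}=\{\Delta^{(k)}:\Delta\in\mathbf a\}$; $\mathbf a^{(l_1,\dots,l_r)}=(\cdots(\mathbf a^{(l_1)})\cdots)^{(l_r)}$. $S(\mathbf a)_k$ is the set of $\mathbf c\in S(\mathbf a)$ such that $\deg(\mathbf c^{(k)})=\deg(\mathbf a^{(k)})$ and $\mathbf c$ contains no pair of linked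 segments $\{\Delta,\Delta'\}$ with $e(\Delta)=k-1$, $e(\Delta')=k$. For a sequence of integers $(l_1,\dots,l_r)$, $$S(\mathbf a)_{l_1,\dots,l_r}=\{\mathbf c\in S(\mathbf a):\mathbf c^{(l_1,\dots,l_i)}\in S(\mathbf a^{(l_1,\dots,l_i)})_{l_{i+1}}\text{ for }0\le i\le r-1\}.$$ *)

theory Defs
  imports Main "HOL-Library.Multiset" "HOL-Combinatorics.Transposition" "HOL-Combinatorics.Permutations"
begin

definition segment :: "int set \<Rightarrow> bool" where
  "segment \<Delta> \<longleftrightarrow> (\<exists>i j. i \<le> j \<and> \<Delta> = {i..j})"

definition seg_b :: "int set \<Rightarrow> int" where
  "seg_b \<Delta> = Min \<Delta>"

definition seg_e :: "int set \<Rightarrow> int" where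
  "seg_e \<Delta> = Max \<Delta>"

definition multisegment :: "int set multiset \<Rightarrow> bool" where
  "multisegment a \<longleftrightarrow> (\<forall>\<Delta> \<in># a. segment \<Delta>)"

definition discard_empty :: "int set multiset \<Rightarrow> int set multiset" where
  "discard_empty a = filter_mset (\<lambda>\<Delta>. \<Delta> \<noteq> {}) a"

definition deg :: "int set multiset \<Rightarrow> nat" where
  "deg a = (\<Sum>\<Delta>\<in>#a. card \<Delta>)"

definition linked :: "int set \<Rightarrow> int set \<Rightarrow> bool" where
  "linked \<Delta> \<Delta>' \<longleftrightarrow> segment \<Delta> \<and> segment \<Delta>' \<and>
     \<not> \<Delta> \<subseteq> \<Delta>' \<and> \<not> \<Delta>' \<subseteq> \<Delta> \<and> segment (\<Delta> \<union> \<Delta>')"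

definition elem_op :: "int set multiset \<Rightarrow> int set multiset \<Rightarrow> bool" where
  "elem_op a b \<longleftrightarrow> (\<exists>\<Delta> \<Delta>'. {#\<Delta>, \<Delta>'#} \<subseteq># a \<and> linked \<Delta> \<Delta>' \<and>
     b = a - {#\<Delta>, \<Delta>'#} + discard_empty {#\<Delta> \<union> \<Delta>', \<Delta> \<inter> \<Delta>'#})"

definition ms_le :: "int set multiset \<Rightarrow> int set multiset \<Rightarrow> bool" where
  "ms_le b a \<longleftrightarrow> elem_op\<^sup>*\<^sup>* a b"

definition S :: "int set multiset \<Rightarrow> int set multiset set" where
  "S a = {b. ms_le b a}"

(* Permutations in S_N are functions on nat permuting {1..N}; products are compositions. *)

definition simple_transp :: "nat \<Rightarrow> nat \<Rightarrow> nat" where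
  "simple_transp i = transpose i (Suc i)"

definition perm_length :: "nat \<Rightarrow> (nat \<Rightarrow> nat) \<Rightarrow> nat" where
  "perm_length N w = (LEAST n. \<exists>is. length is = n \<and> set is \<subseteq> {1..<N} \<and>
     w = foldr (\<circ>) (map simple_transp is) id)"

definition bruhat_step :: "nat \<Rightarrow> (nat \<Rightarrow> nat) \<Rightarrow> (nat \<Rightarrow> nat) \<Rightarrow> bool" where
  "bruhat_step N u v \<longleftrightarrow> u permutes {1..N} \<and>
     (\<exists>p\<in>{1..N}. \<exists>q\<in>{1..N}. p \<noteq> q \<and> v = u \<circ> transpose p q) \<and>
     perm_length N u < perm_length N v"

definition bruhat_less :: "nat \<Rightarrow> (nat \<Rightarrow> nat) \<Rightarrow> (nat \<Rightarrow> nat) \<Rightarrow> bool" where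
  "bruhat_less N = (bruhat_step N)\<^sup>+\<^sup>+"

definition SN_J :: "nat \<Rightarrow> (nat \<Rightarrow> nat) set \<Rightarrow> (nat \<Rightarrow> nat) set \<Rightarrow> (nat \<Rightarrow> nat) set" where
  "SN_J N J1 J2 = {w. w permutes {1..N} \<and>
     (\<forall>s1\<in>J1. bruhat_less N w (s1 \<circ> w)) \<and> (\<forall>s2\<in>J2. bruhat_less N w (w \<circ> s2))}"

(* The i-th smallest beginning (end), counted from 1, is the list entry at position i - 1. *)

definition J2_of :: "int set multiset \<Rightarrow> (nat \<Rightarrow> nat) set" where
  "J2_of a = (let k = sorted_list_of_multiset (image_mset seg_b a) in
     {simple_transp i |i. i \<in> {1..<size a} \<and> k ! (i - 1) = k ! i})"

definition J1_of :: "int set multiset \<Rightarrow> (nat \<Rightarrow> nat) set" where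
  "J1_of a = (let l = sorted_list_of_multiset (image_mset seg_e a) in
     {simple_transp i |i. i \<in> {1..<size a} \<and> l ! (i - 1) = l ! i})"

(* The segments Delta_1, ..., Delta_N of some a_Id; values of D outside {1..N} are irrelevant. *)

definition Id_segments ::
  "nat \<Rightarrow> (nat \<Rightarrow> nat) set \<Rightarrow> (nat \<Rightarrow> nat) set \<Rightarrow> (nat \<Rightarrow> int set) \<Rightarrow> bool" where
  "Id_segments N J1 J2 D \<longleftrightarrow>
     (\<forall>i\<in>{1..N}. segment (D i)) \<and>
     (\<forall>i\<in>{1..<N}. seg_e (D i) \<le> seg_e (D (Suc i)) \<and>
        (seg_e (D i) = seg_e (D (Suc i)) \<longleftrightarrow> simple_transp i \<in> J1)) \<and>
     (\<forall>i\<in>{1..<N}. seg_b (D i) \<le> seg_b (D (Suc i)) \<and>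
        (seg_b (D i) = seg_b (D (Suc i)) \<longleftrightarrow> simple_transp i \<in> J2)) \<and>
     (1 \<le> N \<longrightarrow> seg_b (D N) \<le> seg_e (D 1))"

definition a_Id :: "nat \<Rightarrow> (nat \<Rightarrow> int set) \<Rightarrow> int set multiset" where
  "a_Id N D = (\<Sum>i\<in>{1..N}. {#D i#})"

definition a_perm :: "nat \<Rightarrow> (nat \<Rightarrow> int set) \<Rightarrow> (nat \<Rightarrow> nat) \<Rightarrow> int set multiset" where
  "a_perm N D w = (\<Sum>i\<in>{1..N}. {#{seg_b (D i)..seg_e (D (w i))}#})"

definition parabolic_type ::
  "nat \<Rightarrow> (nat \<Rightarrow> nat) set \<Rightarrow> (nat \<Rightarrow> nat) set \<Rightarrow> int set multiset \<Rightarrow> bool" where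
  "parabolic_type N J1 J2 c \<longleftrightarrow> (\<exists>D. Id_segments N J1 J2 D \<and> c \<in> S (a_Id N D))"

definition seg_trunc :: "int \<Rightarrow> int set \<Rightarrow> int set" where
  "seg_trunc k \<Delta> = (if seg_e \<Delta> = k then {seg_b \<Delta>..k - 1} else \<Delta>)"

definition trunc :: "int \<Rightarrow> int set multiset \<Rightarrow> int set multiset" where
  "trunc k a = discard_empty (image_mset (seg_trunc k) a)"

definition truncs :: "int list \<Rightarrow> int set multiset \<Rightarrow> int set multiset" where
  "truncs ls a = fold trunc ls a"

definition S_sub :: "int set multiset \<Rightarrow> int \<Rightarrow> int set multiset set" where
  "S_sub a k = {c \<in> S a. deg (trunc k c) = deg (trunc k a) \<and>
     \<not> (\<exists>\<Delta> \<in># c. \<exists>\<Delta>' \<in># c. linked \<Delta> \<Delta>' \<and> seg_e \<Delta> = k - 1 \<and> seg_e \<Delta>' = k)}"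

definition S_subs :: "int set multiset \<Rightarrow> int list \<Rightarrow> int set multiset set" where
  "S_subs a ls = {c \<in> S a. \<forall>i<length ls.
     truncs (take i ls) c \<in> S_sub (truncs (take i ls) a) (ls ! i)}"

definition poset_iso :: "int set multiset set \<Rightarrow> int set multiset set \<Rightarrow> bool" where
  "poset_iso A B \<longleftrightarrow> (\<exists>f. bij_betw f A B \<and>
     (\<forall>x\<in>A. \<forall>y\<in>A. ms_le x y \<longleftrightarrow> ms_le (f x) (f y)))"

end

theory Submission
  imports Defs "HOL-Library.Product_Lexorder"
begin

text \<open>Move all ends of \<open>a\<close> up by the same large number \<open>M\<close>, so that in the resulting multisegment \<open>A\<close>
  every beginning is at most every end. The coincidences among beginnings and among ends do not
  change, so \<open>A\<close> pairs the beginnings and ends of some \<open>a_Id\<close> for \<open>J1\<close>, \<open>J2\<close>. The sorted pairing is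
  above every other pairing, because strictly nested segments can be uncrossed by the inverse of an
  elementary operation; so \<open>A\<close> is of parabolic type (\<open>meeting_parabolic\<close>). Among the permutations
  that produce \<open>A\<close>, one of minimal length lies in \<open>SN_J N J1 J2\<close>: a factor from \<open>J1\<close> or \<open>J2\<close> does not
  change the multisegment, and by parity it does change the length.

  Truncating \<open>M\<close> times at \<open>L, L + 1, \<dots>, H\<close>, for an interval \<open>[L, H]\<close> that contains all coordinates,
  moves every end down by \<open>M\<close> again, and at no stage does an end move onto a value that is already
  an end. So the truncations amount to one relabelling of ends by a map \<open>\<tau>\<close> that is strictly
  increasing on the ends of \<open>A\<close>, they send \<open>A\<close> to \<open>a\<close>, and comparing degrees shows that the set
  \<open>S_subs\<close> consists of those \<open>C\<close> below \<open>A\<close> whose segments \<open>[b, e]\<close> all satisfy \<open>b \<le> \<tau> e + 1\<close>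
  (\<open>fits\<close>, \<open>S_subs_eq\<close>). On this set the relabelling is compatible with elementary operations, and
  elementary operations below \<open>a\<close> lift to it (\<open>S_relabel\<close>, \<open>S_lift\<close>). It is injective there, since
  the segments that became empty are determined by the missing beginnings. This gives the isomorphism
  of posets.

  The set in question is closed under passing to larger elements of \<open>S A\<close>. It therefore consists of
  all elements above its smallest one, which exists because \<open>S a\<close> has one: a multisegment without
  linked pairs is determined by its support, and elementary operations preserve the support and
  terminate (\<open>S_has_least\<close>).\<close>

section \<open>Segments and elementary operations in coordinates\<close>

lemma seg_b_atLeastAtMost [simp]: "i \<le> j \<Longrightarrow> seg_b {i..j} = i"
  by (auto simp: seg_b_def intro: Min_eqI)

lemma seg_e_atLeastAtMost [simp]: "i \<le> j \<Longrightarrow> seg_e {i..j} = j"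
  by (auto simp: seg_e_def intro: Max_eqI)

lemma seg_singleton [simp]: "seg_b {i} = i" "seg_e {i} = i"
  by (simp_all add: seg_b_def seg_e_def)

lemma segment_atLeastAtMost [simp]: "segment {i..j} \<longleftrightarrow> i \<le> j"
  by (auto simp: segment_def)

lemma segment_eq: "segment \<Delta> \<Longrightarrow> {seg_b \<Delta>..seg_e \<Delta>} = \<Delta>"
  and segment_seg_b_le: "segment \<Delta> \<Longrightarrow> seg_b \<Delta> \<le> seg_e \<Delta>"
  by (auto simp: segment_def)

lemma discard_empty_simps [simp]:
  "discard_empty {#} = {#}"
  "discard_empty (add_mset \<Delta> R) = (if \<Delta> = {} then discard_empty R else add_mset \<Delta> (discard_empty R))"
  "discard_empty (R + R') = discard_empty R + discard_empty R'"
  by (auto simp: discard_empty_def)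

lemma linked_coordinates:
  assumes "linked \<Delta> \<Delta>'"
  obtains i j i' j' where "i < i'" "j < j'" "i' \<le> j + 1" "{#\<Delta>, \<Delta>'#} = {#{i..j}, {i'..j'}#}"
proof -
  obtain p q p' q' where D: "\<Delta> = {p..q}" "\<Delta>' = {p'..q'}" "p \<le> q" "p' \<le> q'"
    using assms by (auto simp: linked_def segment_def)
  have sub: "\<not> (p' \<le> p \<and> q \<le> q')" "\<not> (p \<le> p' \<and> q' \<le> q)"
    using assms D by (auto simp: linked_def)
  obtain x y where xy: "{p..q} \<union> {p'..q'} = {x..y}"
    using assms D by (auto simp: linked_def segment_def)
  have conv: "z \<in> {p..q} \<union> {p'..q'}"
    if "u \<in> {p..q} \<union> {p'..q'}" "v \<in> {p..q} \<union> {p'..q'}" "u \<le> z" "z \<le> v" for u v z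
    using that unfolding xy by auto
  show thesis
  proof (cases "p < p'")
    case True
    then have "p' \<le> q + 1" using conv[of p p' "p' - 1"] D by auto
    then show thesis using True sub D by (intro that[of p p' q q']) auto
  next
    case False
    then have "p' < p" using sub by linarith
    moreover have "p \<le> q' + 1" using conv[of p' p "p - 1"] D \<open>p' < p\<close> by auto
    ultimately show thesis using sub D by (intro that[of p' p q' q]) auto
  qed
qed

lemma linkedI:
  assumes "i < i'" "j < j'" "i' \<le> j + 1"
  shows "linked {i..j} {i'..j'}"
proof -
  have "{i..j} \<union> {i'..j'} = {i..j'}" using assms by auto
  then show ?thesis using assms by (auto simp: linked_def)
qed

text \<open>In coordinates an elementary operation exchanges the ends of \<open>[i, j]\<close> and \<open>[i', j']\<close>, where
  \<open>i < i'\<close>, \<open>j < j'\<close> and \<open>i' \<le> j + 1\<close>. In the extreme case \<open>i' = j + 1\<close> the new segment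
  \<open>[i', j]\<close> is empty and is discarded.\<close>

lemma elem_op_iff:
  "elem_op X Y \<longleftrightarrow> (\<exists>R i j i' j'. i < i' \<and> j < j' \<and> i' \<le> j + 1 \<and>
     X = R + {#{i..j}, {i'..j'}#} \<and> Y = R + discard_empty {#{i..j'}, {i'..j}#})" (is "?l \<longleftrightarrow> ?r")
proof
  assume ?l
  then obtain \<Delta> \<Delta>' where 1: "{#\<Delta>, \<Delta>'#} \<subseteq># X" "linked \<Delta> \<Delta>'"
    "Y = X - {#\<Delta>, \<Delta>'#} + discard_empty {#\<Delta> \<union> \<Delta>', \<Delta> \<inter> \<Delta>'#}"
    by (auto simp: elem_op_def)
  obtain i j i' j' where 2: "i < i'" "j < j'" "i' \<le> j + 1" "{#\<Delta>, \<Delta>'#} = {#{i..j}, {i'..j'}#}"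
    using linked_coordinates[OF 1(2)] by metis
  have "(\<Delta> = {i..j} \<and> \<Delta>' = {i'..j'}) \<or> (\<Delta> = {i'..j'} \<and> \<Delta>' = {i..j})"
    using 2(4) by (auto simp: add_eq_conv_ex)
  then have "\<Delta> \<union> \<Delta>' = {i..j'} \<and> \<Delta> \<inter> \<Delta>' = {i'..j}" using 2 by auto
  then have "Y = (X - {#\<Delta>, \<Delta>'#}) + discard_empty {#{i..j'}, {i'..j}#}" using 1 by simp
  moreover have "X = (X - {#\<Delta>, \<Delta>'#}) + {#{i..j}, {i'..j'}#}"
    using subset_mset.diff_add[OF 1(1)] by (simp only: 2(4))
  ultimately show ?r using 2(1-3) by blast
next
  assume ?r
  then obtain R i j i' j' where 1: "i < i'" "j < j'" "i' \<le> j + 1"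
    "X = R + {#{i..j}, {i'..j'}#}" "Y = R + discard_empty {#{i..j'}, {i'..j}#}"
    by blast
  have "{i..j} \<union> {i'..j'} = {i..j'}" "{i..j} \<inter> {i'..j'} = {i'..j}" using 1 by auto
  then show ?l unfolding elem_op_def using 1 linkedI[OF 1(1-3)]
    by (intro exI[of _ "{i..j}"] exI[of _ "{i'..j'}"]) simp
qed

lemma elem_op_cases:
  assumes "elem_op X Y"
  obtains R i j i' j' where "i < i'" "j < j'" "i' \<le> j + 1"
    "X = R + {#{i..j}, {i'..j'}#}" "Y = R + discard_empty {#{i..j'}, {i'..j}#}"
  using assms by (auto simp: elem_op_iff)

lemma elem_opI:
  assumes "i < i'" "j < j'" "i' \<le> j + 1"
    "X = R + {#{i..j}, {i'..j'}#}" "Y = R + discard_empty {#{i..j'}, {i'..j}#}"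
  shows "elem_op X Y"
  using assms unfolding elem_op_iff by blast

lemma elem_op_multisegment: "elem_op X Y \<Longrightarrow> multisegment X \<Longrightarrow> multisegment Y"
  by (erule elem_op_cases) (auto simp: multisegment_def)

lemma S_trans: "c \<in> S b \<Longrightarrow> b \<in> S a \<Longrightarrow> c \<in> S a"
  by (auto simp: S_def ms_le_def)

lemma S_refl: "a \<in> S a"
  by (auto simp: S_def ms_le_def)


section \<open>The smallest element below a multisegment\<close>

text \<open>The number of segments of \<open>X\<close>, with multiplicity, that contain \<open>[x, y]\<close>. For \<open>x = y\<close> these
  numbers form the support of \<open>X\<close>, which no elementary operation changes.\<close>

definition mult_containing :: "int \<Rightarrow> int \<Rightarrow> int set multiset \<Rightarrow> nat" where
  "mult_containing x y X = size (filter_mset (\<lambda>\<Delta>. {x..y} \<subseteq> \<Delta>) X)"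

lemma elem_op_mult_containing_point:
  "elem_op X Y \<Longrightarrow> mult_containing z z Y = mult_containing z z X"
  by (erule elem_op_cases) (auto simp: mult_containing_def)

text \<open>A multisegment to which no elementary operation applies.\<close>

definition unlinked :: "int set multiset \<Rightarrow> bool" where
  "unlinked X \<longleftrightarrow> (\<forall>\<Delta>\<in>#X. \<forall>\<Delta>'\<in>#X. \<not> linked \<Delta> \<Delta>')"

text \<open>If \<open>\<Delta> \<supseteq> [x, y]\<close> misses \<open>y + 1\<close>, and \<open>\<Delta>' \<ni> y + 1\<close> does not contain \<open>[x, y]\<close>, then \<open>\<Delta>\<close> and
  \<open>\<Delta>'\<close> are linked. Hence in an unlinked multisegment the segments containing \<open>[x, y]\<close> and those
  containing \<open>y + 1\<close> form two families, one inside the other.\<close>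

lemma mult_containing_Suc:
  assumes "multisegment X" "unlinked X" "x \<le> y"
  shows "mult_containing x (y + 1) X = min (mult_containing x y X) (mult_containing (y + 1) (y + 1) X)"
proof -
  let ?P = "\<lambda>\<Delta>. {x..y} \<subseteq> \<Delta>" and ?Q = "\<lambda>\<Delta>::int set. {y + 1..y + 1} \<subseteq> \<Delta>"
  have PQ: "filter_mset (\<lambda>\<Delta>. {x..y + 1} \<subseteq> \<Delta>) X = filter_mset (\<lambda>\<Delta>. ?P \<Delta> \<and> ?Q \<Delta>) X"
  proof (rule filter_mset_cong)
    have "{x..y + 1} = {x..y} \<union> {y + 1..y + 1}" using assms(3) by auto
    then show "({x..y + 1} \<subseteq> \<Delta>) = (?P \<Delta> \<and> ?Q \<Delta>)" for \<Delta> by auto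
  qed simp
  have "(\<forall>\<Delta>\<in>#X. ?P \<Delta> \<longrightarrow> ?Q \<Delta>) \<or> (\<forall>\<Delta>\<in>#X. ?Q \<Delta> \<longrightarrow> ?P \<Delta>)"
  proof (rule ccontr)
    assume "\<not> ?thesis"
    then obtain \<Delta> \<Delta>' where D: "\<Delta> \<in># X" "?P \<Delta>" "\<not> ?Q \<Delta>" "\<Delta>' \<in># X" "?Q \<Delta>'" "\<not> ?P \<Delta>'" by blast
    obtain i j i' j' where ij: "\<Delta> = {i..j}" "\<Delta>' = {i'..j'}" "i \<le> j" "i' \<le> j'"
      using assms(1) D by (metis multisegment_def segment_def)
    have "i \<le> x" "j = y" using D ij assms(3) by auto
    moreover have "x < i'" "i' \<le> y + 1" "y + 1 \<le> j'" using D ij assms(3) by auto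
    ultimately have "linked \<Delta> \<Delta>'" unfolding ij by (intro linkedI) auto
    then show False using assms(2) D by (auto simp: unlinked_def)
  qed
  then show ?thesis
  proof
    assume a: "\<forall>\<Delta>\<in>#X. ?P \<Delta> \<longrightarrow> ?Q \<Delta>"
    have "filter_mset (\<lambda>\<Delta>. ?P \<Delta> \<and> ?Q \<Delta>) X = filter_mset ?P X"
      using a by (intro filter_mset_cong) auto
    moreover have "filter_mset (\<lambda>\<Delta>. ?P \<Delta> \<and> ?Q \<Delta>) X \<subseteq># filter_mset ?Q X"
      using multiset_filter_subset[of ?P "filter_mset ?Q X"] by (simp only: filter_filter_mset conj_commute)
    ultimately show ?thesis unfolding mult_containing_def PQ
      by (metis size_mset_mono min.absorb1 min.absorb2)
  next
    assume a: "\<forall>\<Delta>\<in>#X. ?Q \<Delta> \<longrightarrow> ?P \<Delta>"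
    have "filter_mset (\<lambda>\<Delta>. ?P \<Delta> \<and> ?Q \<Delta>) X = filter_mset ?Q X"
      using a by (intro filter_mset_cong) auto
    moreover have "filter_mset (\<lambda>\<Delta>. ?P \<Delta> \<and> ?Q \<Delta>) X \<subseteq># filter_mset ?P X"
      using multiset_filter_subset[of ?Q "filter_mset ?P X"] by (simp only: filter_filter_mset)
    ultimately show ?thesis unfolding mult_containing_def PQ
      by (metis size_mset_mono min.absorb1 min.absorb2)
  qed
qed

text \<open>Inclusion and exclusion: the segments equal to \<open>[x, y]\<close> are those that contain \<open>[x, y]\<close> but
  neither \<open>x - 1\<close> nor \<open>y + 1\<close>.\<close>

lemma count_segment:
  assumes "multisegment X" "x \<le> y"
  shows "int (count X {x..y}) = int (mult_containing x y X) - int (mult_containing (x - 1) y X)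
    - int (mult_containing x (y + 1) X) + int (mult_containing (x - 1) (y + 1) X)"
  using assms(1)
proof (induction X)
  case empty
  then show ?case by (simp add: mult_containing_def)
next
  case (add \<Delta> X)
  obtain i j where ij: "\<Delta> = {i..j}" "i \<le> j" using add.prems by (auto simp: multisegment_def segment_def)
  have IH: "int (count X {x..y}) = int (mult_containing x y X) - int (mult_containing (x - 1) y X)
    - int (mult_containing x (y + 1) X) + int (mult_containing (x - 1) (y + 1) X)"
    using add by (simp add: multisegment_def)
  have "mult_containing u v (add_mset \<Delta> X) = (if i \<le> u \<and> v \<le> j then 1 else 0) + mult_containing u v X"
    if "u \<le> v" for u v
    using that by (simp add: mult_containing_def ij)
  note m = this[OF assms(2)] this[of "x - 1" y] this[of x "y + 1"] this[of "x - 1" "y + 1"]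
  have "count (add_mset \<Delta> X) {x..y} = (if i = x \<and> j = y then 1 else 0) + count X {x..y}"
    using ij assms(2) by simp
  moreover have "(if i = x \<and> j = y then 1 else 0 :: int) =
      (if i \<le> x \<and> y \<le> j then 1 else 0) - (if i \<le> x - 1 \<and> y \<le> j then 1 else 0)
      - (if i \<le> x \<and> y + 1 \<le> j then 1 else 0) + (if i \<le> x - 1 \<and> y + 1 \<le> j then 1 else 0)"
    by auto
  ultimately show ?case using IH m assms(2) by (simp only: of_nat_add of_nat_1 of_nat_0 if_distrib[of int])
qed

text \<open>By the two preceding lemmas the support of an unlinked multisegment determines first all numbers
  \<open>mult_containing x y X\<close> and then all multiplicities.\<close>

lemma unlinked_unique:
  assumes "multisegment X" "unlinked X" "multisegment Y" "unlinked Y"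
    and "\<And>z. mult_containing z z X = mult_containing z z Y"
  shows "X = Y"
proof (rule multiset_eqI)
  have mc: "mult_containing x y X = mult_containing x y Y" if "x \<le> y" for x y
    using that
  proof (induction y rule: int_ge_induct)
    case base
    then show ?case using assms(5) by simp
  next
    case (step y)
    then show ?case using mult_containing_Suc[OF assms(1,2) step.hyps]
      mult_containing_Suc[OF assms(3,4) step.hyps] assms(5) by simp
  qed
  fix \<Delta>
  show "count X \<Delta> = count Y \<Delta>"
  proof (cases "segment \<Delta>")
    case True
    then obtain x y where xy: "x \<le> y" "\<Delta> = {x..y}" by (auto simp: segment_def)
    then have "int (count X \<Delta>) = int (count Y \<Delta>)"
      using count_segment[OF assms(1) xy(1)] count_segment[OF assms(3) xy(1)] mc by simp
    then show ?thesis by simp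
  next
    case False
    then have "\<Delta> \<notin># X" "\<Delta> \<notin># Y" using assms(1,3) by (auto simp: multisegment_def)
    then show ?thesis by (simp add: not_in_iff)
  qed
qed

text \<open>A measure that strictly increases under elementary operations and is bounded in terms of the
  degree, which is invariant.\<close>

definition sum_squares :: "int set multiset \<Rightarrow> nat" where
  "sum_squares X = (\<Sum>\<Delta>\<in>#X. (card \<Delta>)\<^sup>2)"

lemma elem_op_deg: "elem_op X Y \<Longrightarrow> deg Y = deg X"
  by (erule elem_op_cases) (auto simp: deg_def)

lemma elem_op_sum_squares:
  assumes "elem_op X Y"
  shows "sum_squares X < sum_squares Y"
proof -
  obtain R i j i' j' where 1: "i < i'" "j < j'" "i' \<le> j + 1"
    "X = R + {#{i..j}, {i'..j'}#}" "Y = R + discard_empty {#{i..j'}, {i'..j}#}"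
    using elem_op_cases[OF assms] by metis
  have c: "int (card {u..v}) = v - u + 1" if "u \<le> v + 1" for u v :: int using that by simp
  have "int (sum_squares Y) = int (sum_squares R) + (j' - i + 1)\<^sup>2 + (j - i' + 1)\<^sup>2"
    using 1 by (auto simp: sum_squares_def c)
  moreover have "int (sum_squares X) = int (sum_squares R) + (j - i + 1)\<^sup>2 + (j' - i' + 1)\<^sup>2"
    using 1 by (auto simp: sum_squares_def c)
  moreover have "0 < (i' - i) * (j' - j)" using 1 by simp
  ultimately have "int (sum_squares X) < int (sum_squares Y)"
    by (simp add: power2_eq_square algebra_simps)
  then show ?thesis by simp
qed

lemma sum_squares_le: "sum_squares X \<le> (deg X)\<^sup>2"
  by (induction X) (auto simp: sum_squares_def deg_def power2_eq_square algebra_simps)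

lemma S_invariants:
  assumes "b \<in> S a" "multisegment a"
  shows "multisegment b \<and> deg b = deg a \<and> (\<forall>z. mult_containing z z b = mult_containing z z a)"
  using assms(1)[unfolded S_def ms_le_def mem_Collect_eq]
  by (induction rule: rtranclp_induct)
    (use assms(2) elem_op_multisegment elem_op_deg elem_op_mult_containing_point in auto)

lemma unlinked_below:
  assumes "multisegment a"
  obtains m where "m \<in> S a" "unlinked m"
proof -
  have "sum_squares b < Suc ((deg a)\<^sup>2)" if "b \<in> S a" for b
    using sum_squares_le[of b] S_invariants[OF that assms] by simp
  then obtain m where m: "m \<in> S a" "\<And>b. b \<in> S a \<Longrightarrow> sum_squares b \<le> sum_squares m"
    using ex_has_greatest_nat[of "\<lambda>b. b \<in> S a" a sum_squares] S_refl by metis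
  have "unlinked m"
    unfolding unlinked_def
  proof (intro ballI notI)
    fix \<Delta> \<Delta>' assume D: "\<Delta> \<in># m" "\<Delta>' \<in># m" "linked \<Delta> \<Delta>'"
    then have "\<Delta> \<noteq> \<Delta>'" by (auto simp: linked_def)
    obtain m' where m': "m = add_mset \<Delta> m'" using D(1) by (metis mset_add)
    then have "\<Delta>' \<in># m'" using D(2) \<open>\<Delta> \<noteq> \<Delta>'\<close> by simp
    then have "{#\<Delta>, \<Delta>'#} \<subseteq># m" unfolding m' by simp
    then obtain b where b: "elem_op m b" using D by (auto simp: elem_op_def)
    then have "b \<in> S a" using m(1) by (auto simp: S_def ms_le_def)
    then show False using m(2) elem_op_sum_squares[OF b] by fastforce
  qed
  then show thesis using that m by blast
qed

lemma S_has_least: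
  assumes "multisegment a"
  obtains m where "m \<in> S a" "\<And>c. c \<in> S a \<Longrightarrow> ms_le m c"
proof -
  obtain m where m: "m \<in> S a" "unlinked m" using unlinked_below[OF assms] .
  have "ms_le m c" if c: "c \<in> S a" for c
  proof -
    have cm: "multisegment c" using S_invariants[OF c assms] by simp
    obtain m' where m': "m' \<in> S c" "unlinked m'" using unlinked_below[OF cm] .
    have "m' = m"
      using S_invariants[OF m(1) assms] S_invariants[OF c assms] S_invariants[OF m'(1) cm] m m'
      by (intro unlinked_unique) auto
    then show ?thesis using m' by (simp add: S_def)
  qed
  then show thesis using that m by blast
qed


section \<open>Relabelling the ends of a multisegment\<close>

text \<open>Replace every end \<open>e\<close> by \<open>\<tau> e\<close> and discard the segments that become empty.\<close>

definition relabel :: "(int \<Rightarrow> int) \<Rightarrow> int set multiset \<Rightarrow> int set multiset" where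
  "relabel \<tau> C = discard_empty (image_mset (\<lambda>\<Delta>. {seg_b \<Delta>..\<tau> (seg_e \<Delta>)}) C)"

text \<open>Relabelling the ends of \<open>C\<close> by \<open>\<tau>\<close> turns no segment into \<open>[b, e]\<close> with \<open>e < b - 1\<close>. The boundary
  case \<open>e = b - 1\<close>, an empty segment of formal length zero, is allowed: it corresponds to an
  intersection that an elementary operation discards.\<close>

definition fits :: "(int \<Rightarrow> int) \<Rightarrow> int set multiset \<Rightarrow> bool" where
  "fits \<tau> C \<longleftrightarrow> (\<forall>\<Delta>\<in>#C. seg_b \<Delta> \<le> \<tau> (seg_e \<Delta>) + 1)"

text \<open>Every beginning is at most every end, that is, any two segments intersect. Below such a
  multisegment nothing is ever discarded, so the multisets of beginnings and of ends are constant.\<close>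

definition meeting :: "int set multiset \<Rightarrow> bool" where
  "meeting C \<longleftrightarrow> multisegment C \<and> (\<forall>\<Delta>\<in>#C. \<forall>\<Delta>'\<in>#C. seg_b \<Delta> \<le> seg_e \<Delta>')"

lemma relabel_simps [simp]:
  "relabel \<tau> {#} = {#}"
  "relabel \<tau> (add_mset \<Delta> C) = discard_empty {#{seg_b \<Delta>..\<tau> (seg_e \<Delta>)}#} + relabel \<tau> C"
  "relabel \<tau> (C + C') = relabel \<tau> C + relabel \<tau> C'"
  by (auto simp: relabel_def)

lemma elem_op_meeting_cases:
  assumes "meeting C" "elem_op C C'"
  obtains R i j i' j' where "i < i'" "j < j'" "i' \<le> j"
    "C = R + {#{i..j}, {i'..j'}#}" "C' = R + {#{i..j'}, {i'..j}#}"
proof -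
  obtain R i j i' j' where 1: "i < i'" "j < j'" "i' \<le> j + 1"
    "C = R + {#{i..j}, {i'..j'}#}" "C' = R + discard_empty {#{i..j'}, {i'..j}#}"
    using elem_op_cases[OF assms(2)] by metis
  have m: "i \<le> j" "i' \<le> j'" using assms(1) 1(4) by (simp_all add: meeting_def multisegment_def)
  have "i' \<le> j" using assms(1) m by (simp add: 1(4) meeting_def)
  then show thesis using 1 m by (intro that[of i i' j j' R]) auto
qed

lemma elem_op_meeting:
  assumes "meeting C" "elem_op C C'"
  shows "meeting C'" "image_mset seg_b C' = image_mset seg_b C" "image_mset seg_e C' = image_mset seg_e C"
proof -
  obtain R i j i' j' where 1: "i < i'" "j < j'" "i' \<le> j"
    "C = R + {#{i..j}, {i'..j'}#}" "C' = R + {#{i..j'}, {i'..j}#}"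
    using elem_op_meeting_cases[OF assms] .
  show b: "image_mset seg_b C' = image_mset seg_b C" and e: "image_mset seg_e C' = image_mset seg_e C"
    using 1 by (simp_all add: add_mset_commute)
  have "meeting C \<longleftrightarrow> multisegment C \<and> (\<forall>x\<in>#image_mset seg_b C. \<forall>y\<in>#image_mset seg_e C. x \<le> y)" for C
    by (simp add: meeting_def)
  moreover have "multisegment C'"
    using elem_op_multisegment[OF assms(2)] assms(1) by (simp add: meeting_def)
  ultimately show "meeting C'" using assms(1) b e by metis
qed

lemma S_meeting:
  assumes "meeting A" "C \<in> S A"
  shows "meeting C \<and> image_mset seg_b C = image_mset seg_b A \<and> image_mset seg_e C = image_mset seg_e A"
  using assms(2)[unfolded S_def ms_le_def mem_Collect_eq]
  by (induction rule: rtranclp_induct) (use assms(1) elem_op_meeting in auto)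

lemma S_ends:
  assumes "meeting A" "C \<in> S A"
  shows "seg_e ` set_mset C = seg_e ` set_mset A"
  using S_meeting[OF assms] by (metis set_image_mset)

text \<open>Among the two segments produced by an elementary operation, the shorter one controls the condition
  \<open>fits\<close>. So this condition passes to larger elements, and where it holds, elementary operations are
  compatible with relabelling.\<close>

lemma elem_op_fits:
  assumes "meeting C" "elem_op C C'" "fits \<tau> C'" "strict_mono_on E \<tau>" "seg_e ` set_mset C \<subseteq> E"
  shows "fits \<tau> C" "elem_op (relabel \<tau> C) (relabel \<tau> C')"
proof -
  obtain R i j i' j' where 1: "i < i'" "j < j'" "i' \<le> j"
    "C = R + {#{i..j}, {i'..j'}#}" "C' = R + {#{i..j'}, {i'..j}#}"
    using elem_op_meeting_cases[OF assms(1,2)] .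
  have "j \<in> E" "j' \<in> E" using assms(5) 1 by auto
  then have tau: "\<tau> j < \<tau> j'" using assms(4) 1 by (simp add: strict_mono_onD)
  have i': "i' \<le> \<tau> j + 1" using assms(3) 1 by (simp add: fits_def)
  show "fits \<tau> C" using assms(3) 1 tau i' by (auto simp: fits_def)
  show "elem_op (relabel \<tau> C) (relabel \<tau> C')"
    using 1 tau i' by (intro elem_opI[of i i' "\<tau> j" "\<tau> j'" _ "relabel \<tau> R"]) auto
qed

lemma S_relabel:
  assumes "meeting A" "C \<in> S A" "fits \<tau> C" "strict_mono_on E \<tau>" "seg_e ` set_mset A \<subseteq> E"
  shows "fits \<tau> A \<and> relabel \<tau> C \<in> S (relabel \<tau> A)"
proof -
  have "elem_op\<^sup>*\<^sup>* A C" using assms(2) by (simp add: S_def ms_le_def)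
  then show ?thesis using assms(3)
  proof (induction rule: rtranclp_induct)
    case base
    then show ?case by (simp add: S_refl)
  next
    case (step C C')
    have C: "meeting C" "seg_e ` set_mset C \<subseteq> E"
      using S_meeting[OF assms(1), of C] S_ends[OF assms(1), of C] assms(5) step.hyps
      by (simp_all add: S_def ms_le_def)
    then have "fits \<tau> C" "elem_op (relabel \<tau> C) (relabel \<tau> C')"
      using elem_op_fits[OF C(1) step.hyps(2) step.prems assms(4)] by auto
    then show ?case using step.IH by (auto simp: S_def ms_le_def)
  qed
qed

text \<open>Conversely, an elementary operation on the relabelled multisegment comes from one on \<open>C\<close>: as all
  segments of \<open>C\<close> intersect, two of them are linked as soon as neither contains the other.\<close>

lemma elem_op_lift:
  assumes "meeting C" "fits \<tau> C" "strict_mono_on E \<tau>" "seg_e ` set_mset C \<subseteq> E"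
    and "elem_op (relabel \<tau> C) D"
  obtains C' where "elem_op C C'" "fits \<tau> C'" "relabel \<tau> C' = D"
proof -
  obtain R i j i' j' where 1: "i < i'" "j < j'" "i' \<le> j + 1"
    "relabel \<tau> C = R + {#{i..j}, {i'..j'}#}" "D = R + discard_empty {#{i..j'}, {i'..j}#}"
    using elem_op_cases[OF assms(5)] by metis
  let ?f = "\<lambda>\<Delta>. {seg_b \<Delta>..\<tau> (seg_e \<Delta>)}"
  define P where "P = filter_mset (\<lambda>\<Delta>. ?f \<Delta> \<noteq> {}) C"
  define Q where "Q = filter_mset (\<lambda>\<Delta>. \<not> ?f \<Delta> \<noteq> {}) C"
  have CPQ: "C = P + Q" unfolding P_def Q_def by (rule multiset_partition)
  have "relabel \<tau> C = image_mset ?f P"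
    unfolding P_def relabel_def discard_empty_def by (simp add: filter_mset_image_mset)
  then have "image_mset ?f P = add_mset {i..j} (add_mset {i'..j'} R)" using 1(4) by simp
  from msed_map_invR[OF this] obtain P' \<Delta> where
    P': "P = add_mset \<Delta> P'" "?f \<Delta> = {i..j}" "image_mset ?f P' = add_mset {i'..j'} R"
    by blast
  from msed_map_invR[OF P'(3)] obtain P'' \<Delta>' where
    P'': "P' = add_mset \<Delta>' P''" "?f \<Delta>' = {i'..j'}" "image_mset ?f P'' = R"
    by blast
  define e e' where "e = seg_e \<Delta>" and "e' = seg_e \<Delta>'"
  have ij: "seg_b \<Delta> = i" "\<tau> e = j" "seg_b \<Delta>' = i'" "\<tau> e' = j'"
    using P'(2) P''(2) 1(1-3) by (auto simp: Icc_eq_Icc e_def e'_def)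
  have C: "C = P'' + Q + {#\<Delta>, \<Delta>'#}" using CPQ P'(1) P''(1) by simp
  have D: "\<Delta> = {i..e}" "\<Delta>' = {i'..e'}"
    using segment_eq[of \<Delta>] segment_eq[of \<Delta>'] assms(1) ij e_def e'_def
    by (auto simp: C meeting_def multisegment_def)
  have le: "i \<le> e'" "i' \<le> e" using assms(1) ij e_def e'_def by (auto simp: C meeting_def)
  have "e \<in> E" "e' \<in> E" using assms(4) by (auto simp: C e_def e'_def)
  then have lt: "e < e'" using ij 1(2) assms(3) by (metis strict_mono_on_less)
  define C' where "C' = P'' + Q + {#{i..e'}, {i'..e}#}"
  show thesis
  proof (rule that[of C'])
    show "elem_op C C'"
      using 1(1) lt le by (intro elem_opI[of i i' e e' _ "P'' + Q"]) (auto simp: C D C'_def)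
    show "fits \<tau> C'"
      using assms(2) ij le 1(1-3) by (auto simp: C C'_def fits_def)
    have "relabel \<tau> Q = {#}"
      unfolding Q_def by (induction C) auto
    moreover have "relabel \<tau> P'' = R"
    proof -
      have "\<forall>\<Delta>\<in>#P. ?f \<Delta> \<noteq> {}" by (simp add: P_def)
      then have "\<forall>\<Delta>\<in>#P''. ?f \<Delta> \<noteq> {}" by (simp add: P'(1) P''(1))
      then show ?thesis using P''(3)
        by (auto simp: relabel_def discard_empty_def filter_mset_eq_conv)
    qed
    ultimately show "relabel \<tau> C' = D"
      using le ij by (simp add: C'_def 1(5))
  qed
qed

lemma S_lift:
  assumes "meeting A" "fits \<tau> A" "strict_mono_on E \<tau>" "seg_e ` set_mset A \<subseteq> E"
    and "D \<in> S (relabel \<tau> A)"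
  obtains C where "C \<in> S A" "fits \<tau> C" "relabel \<tau> C = D"
proof -
  have "elem_op\<^sup>*\<^sup>* (relabel \<tau> A) D" using assms(5) by (simp add: S_def ms_le_def)
  then have "\<exists>C. C \<in> S A \<and> fits \<tau> C \<and> relabel \<tau> C = D"
  proof (induction rule: rtranclp_induct)
    case base
    then show ?case using assms(2) S_refl by blast
  next
    case (step D D')
    then obtain C where C: "C \<in> S A" "fits \<tau> C" "relabel \<tau> C = D" by blast
    have m: "meeting C" "seg_e ` set_mset C \<subseteq> E"
      using S_meeting[OF assms(1) C(1)] S_ends[OF assms(1) C(1)] assms(4) by auto
    then obtain C' where "elem_op C C'" "fits \<tau> C'" "relabel \<tau> C' = D'"
      using elem_op_lift[OF m(1) C(2) assms(3)] step.hyps(2) C(3) by metis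
    then show ?case using C(1) by (auto simp: S_def ms_le_def intro: rtranclp.rtrancl_into_rtrancl)
  qed
  then show thesis using that by blast
qed

text \<open>\<open>C\<close> is recovered from \<open>relabel \<tau> C\<close> and the beginnings of \<open>C\<close>: a beginning \<open>b\<close> that is missing from
  \<open>relabel \<tau> C\<close> belongs to a segment whose end is relabelled to \<open>b - 1\<close>.\<close>

lemma relabel_inverse:
  assumes "multisegment C" "fits \<tau> C" "inj_on \<tau> E" "seg_e ` set_mset C \<subseteq> E"
  shows "C = image_mset (\<lambda>\<Delta>. {seg_b \<Delta>..inv_into E \<tau> (seg_e \<Delta>)}) (relabel \<tau> C)
    + image_mset (\<lambda>b. {b..inv_into E \<tau> (b - 1)}) (image_mset seg_b C - image_mset seg_b (relabel \<tau> C))"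
    (is "C = image_mset ?g _ + image_mset ?h _")
proof -
  have "image_mset seg_b (relabel \<tau> C) \<subseteq># image_mset seg_b C
    \<and> C = image_mset ?g (relabel \<tau> C) + image_mset ?h (image_mset seg_b C - image_mset seg_b (relabel \<tau> C))"
    using assms(1,2,4)
  proof (induction C)
    case (add \<Delta> C)
    let ?B = "image_mset seg_b C" and ?R = "image_mset seg_b (relabel \<tau> C)"
    have IH: "?R \<subseteq># ?B" "C = image_mset ?g (relabel \<tau> C) + image_mset ?h (?B - ?R)"
      using add by (auto simp: multisegment_def fits_def)
    have \<Delta>: "{seg_b \<Delta>..seg_e \<Delta>} = \<Delta>" "seg_b \<Delta> \<le> \<tau> (seg_e \<Delta>) + 1" "inv_into E \<tau> (\<tau> (seg_e \<Delta>)) = seg_e \<Delta>"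
      using add.prems assms(3) segment_eq by (auto simp: multisegment_def fits_def)
    show ?case
    proof (cases "seg_b \<Delta> \<le> \<tau> (seg_e \<Delta>)")
      case True
      then have r: "relabel \<tau> (add_mset \<Delta> C) = add_mset {seg_b \<Delta>..\<tau> (seg_e \<Delta>)} (relabel \<tau> C)" by simp
      show ?thesis unfolding r using True IH \<Delta> by simp
    next
      case False
      then have r: "relabel \<tau> (add_mset \<Delta> C) = relabel \<tau> C" by simp
      have "\<tau> (seg_e \<Delta>) = seg_b \<Delta> - 1" using False \<Delta>(2) by simp
      then have "?h (seg_b \<Delta>) = \<Delta>" using \<Delta> by simp
      moreover have "image_mset seg_b (add_mset \<Delta> C) - ?R = add_mset (seg_b \<Delta>) (?B - ?R)"
        using multiset_diff_union_assoc[OF IH(1), of "{#seg_b \<Delta>#}"] by simp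
      ultimately have "add_mset \<Delta> C = image_mset ?g (relabel \<tau> C)
          + image_mset ?h (image_mset seg_b (add_mset \<Delta> C) - ?R)"
        by (simp only: image_mset_add_mset union_mset_add_mset_right IH(2)[symmetric])
      moreover have "?R \<subseteq># image_mset seg_b (add_mset \<Delta> C)"
        using IH(1) subset_mset.less_imp_le[OF multi_psub_of_add_self] by (simp add: subset_mset.order_trans)
      ultimately show ?thesis unfolding r by blast
    qed
  qed simp
  then show ?thesis by simp
qed

lemma relabel_le_iff:
  assumes "meeting A" "strict_mono_on E \<tau>" "seg_e ` set_mset A \<subseteq> E"
    and "C \<in> S A" "fits \<tau> C" "C' \<in> S A" "fits \<tau> C'"
  shows "ms_le (relabel \<tau> C) (relabel \<tau> C') \<longleftrightarrow> ms_le C C'"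
    and "relabel \<tau> C = relabel \<tau> C' \<Longrightarrow> C = C'"
proof -
  have inj: "inj_on \<tau> E" using assms(2) by (rule strict_mono_on_imp_inj_on)
  have ends: "seg_e ` set_mset X \<subseteq> E" and mt: "meeting X" and bs: "image_mset seg_b X = image_mset seg_b A"
    if "X \<in> S A" for X
    using S_meeting[OF assms(1) that] S_ends[OF assms(1) that] assms(3) by simp_all
  have eq: "X = Y" if "X \<in> S A" "fits \<tau> X" "Y \<in> S A" "fits \<tau> Y" "relabel \<tau> X = relabel \<tau> Y" for X Y
  proof -
    have ms: "multisegment X" "multisegment Y" using mt that(1,3) by (simp_all add: meeting_def)
    show ?thesis
      by (rule trans[OF relabel_inverse[OF ms(1) that(2) inj ends[OF that(1)], unfolded bs[OF that(1)] that(5)]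
          relabel_inverse[OF ms(2) that(4) inj ends[OF that(3)], unfolded bs[OF that(3)], symmetric]])
  qed
  show "relabel \<tau> C = relabel \<tau> C' \<Longrightarrow> C = C'" using eq assms by blast
  show "ms_le (relabel \<tau> C) (relabel \<tau> C') \<longleftrightarrow> ms_le C C'"
  proof
    assume "ms_le C C'"
    then have "C \<in> S C'" by (simp add: S_def)
    from S_relabel[OF mt[OF assms(6)] this assms(5,2) ends[OF assms(6)]]
    show "ms_le (relabel \<tau> C) (relabel \<tau> C')" by (simp add: S_def)
  next
    assume "ms_le (relabel \<tau> C) (relabel \<tau> C')"
    then have "relabel \<tau> C \<in> S (relabel \<tau> C')" by (simp add: S_def)
    from S_lift[OF mt[OF assms(6)] assms(7,2) ends[OF assms(6)] this]
    obtain X where X: "X \<in> S C'" "fits \<tau> X" "relabel \<tau> X = relabel \<tau> C" .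
    then have "X = C" using eq[of X C] assms(4,5) S_trans[OF X(1) assms(6)] by blast
    then show "ms_le C C'" using X(1) by (simp add: S_def)
  qed
qed

lemma poset_iso_inverse:
  assumes "bij_betw f B A" "\<And>x y. x \<in> B \<Longrightarrow> y \<in> B \<Longrightarrow> ms_le (f x) (f y) \<longleftrightarrow> ms_le x y"
  shows "poset_iso A B"
proof -
  let ?g = "the_inv_into B f"
  have "bij_betw ?g A B" using bij_betw_the_inv_into[OF assms(1)] .
  moreover have "ms_le x y \<longleftrightarrow> ms_le (?g x) (?g y)" if "x \<in> A" "y \<in> A" for x y
  proof -
    have "?g x \<in> B" "?g y \<in> B" using calculation that by (auto dest: bij_betwE)
    then show ?thesis using assms(2) f_the_inv_into_f_bij_betw[OF assms(1)] that by metis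
  qed
  ultimately show ?thesis by (auto simp: poset_iso_def)
qed

lemma relabel_poset_iso:
  assumes "meeting A" "strict_mono_on E \<tau>" "seg_e ` set_mset A \<subseteq> E" "fits \<tau> A"
  shows "poset_iso (S (relabel \<tau> A)) {C \<in> S A. fits \<tau> C}"
proof (rule poset_iso_inverse)
  show "bij_betw (relabel \<tau>) {C \<in> S A. fits \<tau> C} (S (relabel \<tau> A))"
    unfolding bij_betw_def
  proof
    show "inj_on (relabel \<tau>) {C \<in> S A. fits \<tau> C}"
      by (rule inj_onI) (use relabel_le_iff(2)[OF assms(1-3)] in blast)
    show "relabel \<tau> ` {C \<in> S A. fits \<tau> C} = S (relabel \<tau> A)"
    proof
      show "relabel \<tau> ` {C \<in> S A. fits \<tau> C} \<subseteq> S (relabel \<tau> A)"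
        using S_relabel[OF assms(1) _ _ assms(2,3)] by blast
      show "S (relabel \<tau> A) \<subseteq> relabel \<tau> ` {C \<in> S A. fits \<tau> C}"
      proof
        fix D assume "D \<in> S (relabel \<tau> A)"
        then obtain C where "C \<in> S A" "fits \<tau> C" "relabel \<tau> C = D"
          by (rule S_lift[OF assms(1,4,2,3)])
        then show "D \<in> relabel \<tau> ` {C \<in> S A. fits \<tau> C}" by blast
      qed
    qed
  qed
qed (use relabel_le_iff(1)[OF assms(1-3)] in blast)

text \<open>The element \<open>a'\<close> is the lift of the smallest element below \<open>relabel \<tau> A\<close>.\<close>

lemma fits_eq_above:
  assumes "meeting A" "strict_mono_on E \<tau>" "seg_e ` set_mset A \<subseteq> E" "fits \<tau> A"
  shows "\<exists>a'\<in>S A. {C \<in> S A. fits \<tau> C} = {C \<in> S A. ms_le a' C}"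
proof -
  have "multisegment (relabel \<tau> A)"
    using assms(1) by (auto simp: multisegment_def relabel_def discard_empty_def)
  then obtain m where m: "m \<in> S (relabel \<tau> A)" "\<And>c. c \<in> S (relabel \<tau> A) \<Longrightarrow> ms_le m c"
    using S_has_least by blast
  obtain a' where a': "a' \<in> S A" "fits \<tau> a'" "relabel \<tau> a' = m"
    using S_lift[OF assms(1,4,2,3) m(1)] .
  have "fits \<tau> C \<longleftrightarrow> ms_le a' C" if C: "C \<in> S A" for C
  proof
    assume f: "fits \<tau> C"
    then have "relabel \<tau> C \<in> S (relabel \<tau> A)" using S_relabel[OF assms(1) C f assms(2,3)] by simp
    then have "ms_le (relabel \<tau> a') (relabel \<tau> C)" using m(2) a'(3) by simp
    then show "ms_le a' C" using relabel_le_iff(1)[OF assms(1-3) a'(1,2) C f] by simp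
  next
    assume "ms_le a' C"
    then have "a' \<in> S C" by (simp add: S_def)
    moreover have "meeting C" "seg_e ` set_mset C \<subseteq> E"
      using S_meeting[OF assms(1) C] S_ends[OF assms(1) C] assms(3) by simp_all
    ultimately show "fits \<tau> C" using S_relabel[of C a' \<tau> E] a'(2) assms(2) by blast
  qed
  then show ?thesis using a'(1) by blast
qed


section \<open>Iterated truncations\<close>

text \<open>The effect of truncation at \<open>k\<close> on an end \<open>e\<close>.\<close>

definition lower :: "int \<Rightarrow> int \<Rightarrow> int" where
  "lower k e = (if e = k then k - 1 else e)"

lemma relabel_id: "multisegment C \<Longrightarrow> relabel (\<lambda>e. e) C = C"
  by (induction C) (auto simp: multisegment_def segment_eq segment_def)

lemma trunc_relabel: "trunc k (relabel \<tau> C) = relabel (\<lambda>e. lower k (\<tau> e)) C"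
proof (induction C)
  case (add \<Delta> C)
  have t: "trunc k (add_mset X Y) = discard_empty {#seg_trunc k X#} + trunc k Y" for X Y
    by (simp add: trunc_def)
  show ?case
    using add by (auto simp: t seg_trunc_def lower_def)
qed (simp add: trunc_def)

lemma fold_trunc_relabel: "truncs ks (relabel \<tau> C) = relabel (\<lambda>e. fold lower ks (\<tau> e)) C"
proof (induction ks arbitrary: \<tau>)
  case (Cons k ks)
  then show ?case using Cons.IH[of "\<lambda>e. lower k (\<tau> e)"] by (simp add: truncs_def trunc_relabel)
qed (simp add: truncs_def)

text \<open>An iterated truncation is a single relabelling, since a discarded segment could only have become
  shorter in later steps.\<close>

lemma truncs_eq_relabel: "multisegment C \<Longrightarrow> truncs ks C = relabel (fold lower ks) C"
  using fold_trunc_relabel[of ks "\<lambda>e. e" C] by (simp add: relabel_id)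

text \<open>When the ends of a multisegment form the set \<open>E\<close> and it is truncated successively at \<open>ks\<close>, the
  value \<open>k - 1\<close> is not an end at the moment of the truncation at \<open>k\<close>.\<close>

fun collision_free :: "int set \<Rightarrow> int list \<Rightarrow> bool" where
  "collision_free E [] \<longleftrightarrow> True"
| "collision_free E (k # ks) \<longleftrightarrow> k - 1 \<notin> E \<and> collision_free (lower k ` E) ks"

lemma lower_strict_mono: "k - 1 \<notin> E \<Longrightarrow> strict_mono_on E (lower k)"
proof (rule strict_mono_onI)
  fix r s assume a: "k - 1 \<notin> E" "r \<in> E" "s \<in> E" "r < s"
  then have "r \<noteq> k - 1" by auto
  then show "lower k r < lower k s" using a(4) by (auto simp: lower_def)
qed

lemma collision_free_take:
  assumes "collision_free E ks"
  shows "strict_mono_on E (fold lower (take n ks))"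
    and "n < length ks \<Longrightarrow> ks ! n - 1 \<notin> fold lower (take n ks) ` E"
proof -
  have "strict_mono_on E (fold lower (take n ks)) \<and>
    (n < length ks \<longrightarrow> ks ! n - 1 \<notin> fold lower (take n ks) ` E)"
    using assms
  proof (induction ks arbitrary: E n)
    case Nil
    then show ?case by (simp add: strict_mono_on_def)
  next
    case (Cons k ks)
    show ?case
    proof (cases n)
      case 0
      then show ?thesis using Cons.prems by (simp add: strict_mono_on_def)
    next
      case (Suc m)
      have 1: "strict_mono_on E (lower k)" using Cons.prems lower_strict_mono by simp
      have 2: "strict_mono_on (lower k ` E) (fold lower (take m ks))"
        "m < length ks \<longrightarrow> ks ! m - 1 \<notin> fold lower (take m ks) ` lower k ` E"
        using Cons by auto
      have "strict_mono_on E (\<lambda>e. fold lower (take m ks) (lower k e))"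
        by (rule strict_mono_onI) (use 1 2(1) in \<open>auto simp: strict_mono_on_def\<close>)
      then show ?thesis using 2(2) by (simp add: Suc comp_def image_image)
    qed
  qed
  then show "strict_mono_on E (fold lower (take n ks))"
    and "n < length ks \<Longrightarrow> ks ! n - 1 \<notin> fold lower (take n ks) ` E" by auto
qed

lemma collision_free_append:
  "collision_free E (ks @ ls) \<longleftrightarrow> collision_free E ks \<and> collision_free (fold lower ks ` E) ls"
  by (induction ks arbitrary: E) (auto simp: image_comp comp_def)

lemma fold_lower_le: "fold lower ks e \<le> e"
proof (induction ks arbitrary: e)
  case (Cons k ks)
  show ?case using Cons.IH[of "lower k e"] by (simp add: lower_def split: if_splits)
qed simp

lemma fold_lower_antimono: "fold lower ks e \<le> fold lower (take n ks) e"
proof -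
  have "fold lower ks e = fold lower (drop n ks) (fold lower (take n ks) e)"
    by (metis append_take_drop_id fold_append comp_apply)
  then show ?thesis using fold_lower_le by simp
qed

text \<open>Truncating at \<open>L, L + 1, \<dots>, H\<close> in this order moves all ends in \<open>[L, H]\<close> down by one: when \<open>k\<close> is
  processed, the ends below \<open>k\<close> have already moved and have left \<open>k - 1\<close> vacant.\<close>

lemma fold_lower_upto:
  "L - 1 \<notin> E \<Longrightarrow> collision_free E [L..H] \<and> (\<forall>e\<in>E. fold lower [L..H] e = (if L \<le> e \<and> e \<le> H then e - 1 else e))"
proof (induction L H arbitrary: E rule: upto.induct)
  case (1 L H)
  show ?case
  proof (cases "L \<le> H")
    case True
    have "(L + 1) - 1 \<notin> lower L ` E" by (auto simp: lower_def)
    from 1(1)[OF True this] 1(2) True show ?thesis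
      by (auto simp: upto_rec1[OF True] lower_def)
  next
    case False
    then show ?thesis by simp
  qed
qed

lemma fold_lower_rounds:
  assumes "E \<subseteq> {L + int M..H}"
  shows "collision_free E (concat (replicate M [L..H]))
    \<and> (\<forall>e\<in>E. fold lower (concat (replicate M [L..H])) e = e - int M)"
  using assms
proof (induction M arbitrary: E)
  case (Suc M)
  have "L - 1 \<notin> E" using Suc.prems by auto
  from fold_lower_upto[OF this, of H]
  have 1: "collision_free E [L..H]" "\<And>e. e \<in> E \<Longrightarrow> fold lower [L..H] e = e - 1"
    using Suc.prems by auto
  have "fold lower [L..H] ` E \<subseteq> {L + int M..H}" using 1(2) Suc.prems by force
  from Suc.IH[OF this] show ?case
    using 1 by (auto simp: collision_free_append)
qed simp

text \<open>The degree of \<open>relabel \<tau> C\<close> is at least the sum of the formal lengths \<open>\<tau> e + 1 - b\<close>, with equality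
  iff no formal length is negative.\<close>

lemma deg_relabel:
  "(\<Sum>e\<in>#image_mset seg_e C. \<tau> e + 1) - (\<Sum>b\<in>#image_mset seg_b C. b) \<le> int (deg (relabel \<tau> C)) \<and>
   (int (deg (relabel \<tau> C)) = (\<Sum>e\<in>#image_mset seg_e C. \<tau> e + 1) - (\<Sum>b\<in>#image_mset seg_b C. b)
     \<longleftrightarrow> fits \<tau> C)"
proof (induction C)
  case (add \<Delta> C)
  have "int (deg (relabel \<tau> (add_mset \<Delta> C))) = int (deg (relabel \<tau> C)) + int (card {seg_b \<Delta>..\<tau> (seg_e \<Delta>)})"
    by (simp add: deg_def)
  moreover have "fits \<tau> (add_mset \<Delta> C) \<longleftrightarrow> seg_b \<Delta> \<le> \<tau> (seg_e \<Delta>) + 1 \<and> fits \<tau> C"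
    by (simp add: fits_def)
  ultimately show ?case using add.IH by simp
qed (simp add: fits_def deg_def)

lemma ends_relabel: "\<Delta> \<in># relabel \<tau> C \<Longrightarrow> seg_e \<Delta> \<in> \<tau> ` seg_e ` set_mset C"
  by (auto simp: relabel_def discard_empty_def)

text \<open>For a collision-free sequence the conditions on linked pairs in \<open>S_subs\<close> are void, and the
  conditions on degrees together say that no segment is discarded too early, which is \<open>fits\<close> for the
  final relabelling.\<close>

lemma S_subs_eq:
  assumes "meeting A" "collision_free (seg_e ` set_mset A) ks" "fits (fold lower ks) A"
  shows "S_subs A ks = {C \<in> S A. fits (fold lower ks) C}"
  unfolding S_subs_def
proof (rule Collect_cong, rule conj_cong[OF refl])
  fix C assume C: "C \<in> S A"
  define T where "T n = fold lower (take n ks)" for n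
  have A: "multisegment A" using assms(1) by (simp add: meeting_def)
  have C': "multisegment C" "image_mset seg_b C = image_mset seg_b A" "image_mset seg_e C = image_mset seg_e A"
    using S_meeting[OF assms(1) C] by (auto simp: meeting_def)
  have ends: "seg_e ` set_mset C = seg_e ` set_mset A" using S_ends[OF assms(1) C] .
  have T: "truncs (take n ks) A = relabel (T n) A" "truncs (take n ks) C = relabel (T n) C" for n
    using truncs_eq_relabel A C' by (simp_all add: T_def)
  have mono: "fits (T n) X" if "fits (fold lower ks) X" for X n
    using that fold_lower_antimono[of ks _ n] unfolding fits_def T_def by (smt (verit))
  have trunc_T: "trunc (ks ! n) (relabel (T n) X) = relabel (T (Suc n)) X" if "n < length ks" for n X
    using that by (simp add: trunc_relabel T_def take_Suc_conv_app_nth comp_def)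
  have deg: "int (deg (relabel (T n) A)) = (\<Sum>e\<in>#image_mset seg_e C. T n e + 1) - (\<Sum>b\<in>#image_mset seg_b C. b)" for n
    using deg_relabel[of "T n" A] mono[OF assms(3), of n] C' by simp
  show "(\<forall>n<length ks. truncs (take n ks) C \<in> S_sub (truncs (take n ks) A) (ks ! n)) \<longleftrightarrow> fits (fold lower ks) C"
    unfolding T
  proof
    assume l: "\<forall>n<length ks. relabel (T n) C \<in> S_sub (relabel (T n) A) (ks ! n)"
    \<comment> \<open>Only the last degree condition is needed; for the empty sequence there is none.\<close>
    show "fits (fold lower ks) C"
    proof (cases "length ks")
      case 0
      then show ?thesis using C' segment_seg_b_le by (fastforce simp: fits_def multisegment_def)
    next
      case (Suc n)
      then have "deg (trunc (ks ! n) (relabel (T n) C)) = deg (trunc (ks ! n) (relabel (T n) A))"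
        using l by (simp add: S_sub_def)
      then have "deg (relabel (T (Suc n)) C) = deg (relabel (T (Suc n)) A)"
        using Suc by (simp add: trunc_T)
      then have "fits (T (Suc n)) C" using deg[of "Suc n"] deg_relabel[of "T (Suc n)" C] by simp
      then show ?thesis using Suc by (simp add: T_def)
    qed
  next
    assume f: "fits (fold lower ks) C"
    show "\<forall>n<length ks. relabel (T n) C \<in> S_sub (relabel (T n) A) (ks ! n)"
    proof (intro allI impI)
      fix n assume n: "n < length ks"
      have "relabel (T n) C \<in> S (relabel (T n) A)"
        using S_relabel[OF assms(1) C mono[OF f, of n]] collision_free_take(1)[OF assms(2), of n]
        by (auto simp: T_def)
      moreover have "deg (trunc (ks ! n) (relabel (T n) C)) = deg (trunc (ks ! n) (relabel (T n) A))"
        using deg[of "Suc n"] deg_relabel[of "T (Suc n)" C] mono[OF f, of "Suc n"]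
        unfolding trunc_T[OF n] by linarith
      moreover have "seg_e \<Delta> \<noteq> ks ! n - 1" if "\<Delta> \<in># relabel (T n) C" for \<Delta>
        using ends_relabel[OF that] collision_free_take(2)[OF assms(2) n] ends by (auto simp: T_def)
      ultimately show "relabel (T n) C \<in> S_sub (relabel (T n) A) (ks ! n)"
        by (auto simp: S_sub_def)
    qed
  qed
qed


section \<open>Double coset representatives of minimal length\<close>

text \<open>The product of the simple transpositions with the given indices, as in the definition of
  \<open>perm_length\<close>.\<close>

definition word :: "nat list \<Rightarrow> nat \<Rightarrow> nat" where
  "word is = foldr (\<circ>) (map simple_transp is) id"

lemma word_append: "word (is @ js) = word is \<circ> word js"
  by (induction "is") (auto simp: word_def)

lemma transpose_word:
  assumes "p \<in> {1..N}" "q \<in> {1..N}"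
  shows "\<exists>is. set is \<subseteq> {1..<N} \<and> transpose p q = word is"
proof -
  have *: "\<exists>is. set is \<subseteq> {1..<N} \<and> transpose p q = word is" if "1 \<le> p" "p < q" "q \<le> N" for p q
    using that(2,3)
  proof (induction q)
    case 0
    then show ?case by simp
  next
    case (Suc q)
    show ?case
    proof (cases "p = q")
      case True
      then show ?thesis using Suc.prems that(1)
        by (intro exI[of _ "[q]"]) (simp add: word_def simple_transp_def)
    next
      case False
      then obtain js where js: "set js \<subseteq> {1..<N}" "transpose p q = word js" using Suc by auto
      have "transpose p (Suc q) = simple_transp q \<circ> (transpose p q \<circ> simple_transp q)"
        using False Suc.prems by (auto simp: simple_transp_def transpose_def fun_eq_iff)
      also have "\<dots> = word ([q] @ js @ [q])"
        unfolding word_append js(2) by (simp add: word_def)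
      finally show ?thesis using js Suc.prems that(1) False by (intro exI[of _ "[q] @ js @ [q]"]) auto
    qed
  qed
  consider "p = q" | "p < q" | "q < p" by linarith
  then show ?thesis
  proof cases
    case 1
    then show ?thesis by (intro exI[of _ "[]"]) (simp add: word_def)
  next
    case 2
    then show ?thesis using * assms by auto
  next
    case 3
    then show ?thesis using *[of q p] assms by (auto simp: transpose_commute)
  qed
qed

lemma permutes_word:
  assumes "w permutes {1..N}"
  shows "\<exists>is. set is \<subseteq> {1..<N} \<and> w = word is"
  using assms finite_atLeastAtMost
proof (induction rule: permutes_induct)
  case id
  then show ?case by (intro exI[of _ "[]"]) (simp add: word_def)
next
  case (swap a b p)
  then obtain "is" js where "set is \<subseteq> {1..<N}" "transpose a b = word is" "set js \<subseteq> {1..<N}" "p = word js"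
    using transpose_word by blast
  then show ?case by (intro exI[of _ "is @ js"]) (simp add: word_append)
qed

lemma sign_word: "permutation (word is) \<and> sign (word is) = (- 1) ^ length is"
proof (induction "is")
  case (Cons i "is")
  have "word (i # is) = simple_transp i \<circ> word is" by (simp add: word_def)
  moreover have "permutation (simple_transp i)" "sign (simple_transp i) = - 1"
    by (simp_all add: simple_transp_def permutation_swap_id sign_swap_id)
  ultimately show ?case
    using Cons permutation_compose[of "simple_transp i" "word is"] sign_compose[of "simple_transp i" "word is"]
    by (simp add: o_def)
qed (simp add: word_def)

lemma sign_perm_length:
  assumes "w permutes {1..N}"
  shows "sign w = (- 1) ^ perm_length N w"
proof -
  have "\<exists>n is. length is = n \<and> set is \<subseteq> {1..<N} \<and> w = foldr (\<circ>) (map simple_transp is) id"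
    using permutes_word[OF assms] by (auto simp: word_def)
  from LeastI_ex[OF this] obtain "is" where "length is = perm_length N w" "w = word is"
    by (auto simp: perm_length_def word_def)
  then show ?thesis using sign_word by metis
qed

text \<open>The parity of the length is the sign of the permutation, so that multiplication by a transposition
  always changes the length.\<close>

lemma perm_length_transpose_neq:
  assumes "w permutes {1..N}" "p \<in> {1..N}" "q \<in> {1..N}" "p \<noteq> q"
  shows "perm_length N (w \<circ> transpose p q) \<noteq> perm_length N w"
proof
  assume a: "perm_length N (w \<circ> transpose p q) = perm_length N w"
  have t: "transpose p q permutes {1..N}" using assms by (simp add: permutes_swap_id)
  have "permutation w" using assms(1) by (auto simp: permutation_permutes)
  then have "sign (w \<circ> transpose p q) = - sign w"
    using assms(4) by (simp add: sign_compose permutation_swap_id sign_swap_id)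
  moreover have "w \<circ> transpose p q permutes {1..N}" using permutes_compose[OF t assms(1)] .
  ultimately have "sign w = - sign w" using a sign_perm_length assms(1) by metis
  then show False by (simp add: sign_def split: if_splits)
qed

lemma bruhat_less_transpose:
  assumes "w permutes {1..N}" "p \<in> {1..N}" "q \<in> {1..N}" "p \<noteq> q"
    and "perm_length N w \<le> perm_length N (w \<circ> transpose p q)"
  shows "bruhat_less N w (w \<circ> transpose p q)"
proof -
  have "bruhat_step N w (w \<circ> transpose p q)"
    unfolding bruhat_step_def using assms perm_length_transpose_neq[OF assms(1-4)]
    by (intro conjI bexI[of _ p] bexI[of _ q]) auto
  then show ?thesis by (auto simp: bruhat_less_def)
qed

lemma simple_transp_inject: "simple_transp i = simple_transp j \<longleftrightarrow> i = j"
proof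
  assume "simple_transp i = simple_transp j"
  then have "simple_transp i i = simple_transp j i" "simple_transp i j = simple_transp j j" by simp_all
  then show "i = j" by (auto simp: simple_transp_def transpose_def split: if_splits)
qed simp

text \<open>A set of permutations stable under left multiplication by \<open>J1\<close> and right multiplication by \<open>J2\<close>
  contains an element of \<open>SN_J N J1 J2\<close>, namely any element of minimal length.\<close>

lemma minimal_length_in_SN_J:
  assumes "w permutes {1..N}" "P w"
    and J1: "J1 \<subseteq> simple_transp ` {1..<N}" and J2: "J2 \<subseteq> simple_transp ` {1..<N}"
    and P1: "\<And>v s. v permutes {1..N} \<Longrightarrow> s \<in> J1 \<Longrightarrow> P v \<Longrightarrow> P (s \<circ> v)"
    and P2: "\<And>v s. v permutes {1..N} \<Longrightarrow> s \<in> J2 \<Longrightarrow> P v \<Longrightarrow> P (v \<circ> s)"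
  shows "\<exists>v. v \<in> SN_J N J1 J2 \<and> P v"
proof -
  obtain v where v: "v permutes {1..N}" "P v"
    and min: "\<And>u. u permutes {1..N} \<Longrightarrow> P u \<Longrightarrow> perm_length N v \<le> perm_length N u"
    using ex_has_least_nat[of "\<lambda>v. v permutes {1..N} \<and> P v" w "perm_length N"] assms(1,2) by blast
  have st: "simple_transp i permutes {1..N}" if "i \<in> {1..<N}" for i
    using that by (simp add: simple_transp_def permutes_swap_id)
  have "bruhat_less N v (s \<circ> v)" if s: "s \<in> J1" for s
  proof -
    obtain i where i: "i \<in> {1..<N}" "s = simple_transp i" using s J1 by blast
    obtain p q where pq: "p \<in> {1..N}" "q \<in> {1..N}" "v p = i" "v q = Suc i"
      using permutes_image[OF v(1)] i(1) by (metis atLeastAtMost_iff atLeastLessThan_iff image_iff le_SucI less_imp_le Suc_leI)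
    \<comment> \<open>A Bruhat step multiplies on the right, so \<open>s\<close> is conjugated by \<open>v\<close>.\<close>
    have eq: "s \<circ> v = v \<circ> transpose p q"
    proof
      fix x
      have "v x = i \<longleftrightarrow> x = p" "v x = Suc i \<longleftrightarrow> x = q" using pq permutes_inj[OF v(1)] by (metis injD)+
      then show "(s \<circ> v) x = (v \<circ> transpose p q) x"
        using pq by (auto simp: i(2) simple_transp_def transpose_def)
    qed
    have "s \<circ> v permutes {1..N}" using permutes_compose[OF v(1) st[OF i(1)]] i(2) by simp
    then have "perm_length N v \<le> perm_length N (s \<circ> v)" using min P1[OF v(1) s v(2)] by blast
    moreover have "p \<noteq> q" using pq by auto
    ultimately show ?thesis unfolding eq using bruhat_less_transpose[OF v(1) pq(1,2)] by simp
  qed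
  moreover have "bruhat_less N v (v \<circ> s)" if s: "s \<in> J2" for s
  proof -
    obtain i where i: "i \<in> {1..<N}" "s = simple_transp i" using s J2 by blast
    have "v \<circ> s permutes {1..N}" using permutes_compose[OF st[OF i(1)] v(1)] i(2) by simp
    then have "perm_length N v \<le> perm_length N (v \<circ> s)" using min P2[OF v(1) s v(2)] by blast
    then show ?thesis using bruhat_less_transpose[OF v(1), of i "Suc i"] i by (auto simp: simple_transp_def)
  qed
  ultimately show ?thesis using v by (auto simp: SN_J_def)
qed


section \<open>The maximal pairing of beginnings and ends\<close>

text \<open>Strictly nested segments can be uncrossed: \<open>C\<close> arises by an elementary operation from the
  multisegment in which the ends of \<open>\<Delta>\<close> and \<open>\<Delta>'\<close> are exchanged.\<close>

lemma elem_op_above_nested: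
  assumes "meeting C" "\<Delta> \<in># C" "\<Delta>' \<in># C" "seg_b \<Delta> < seg_b \<Delta>'" "seg_e \<Delta>' < seg_e \<Delta>"
  shows "\<exists>C'. elem_op C' C \<and> meeting C' \<and> image_mset seg_b C' = image_mset seg_b C \<and>
    image_mset seg_e C' = image_mset seg_e C"
proof -
  define i j' i' j where "i = seg_b \<Delta>" and "j' = seg_e \<Delta>" and "i' = seg_b \<Delta>'" and "j = seg_e \<Delta>'"
  have D: "\<Delta> = {i..j'}" "\<Delta>' = {i'..j}"
    using assms(1-3) segment_eq by (auto simp: meeting_def multisegment_def i_def j'_def i'_def j_def)
  have le: "i < i'" "i' \<le> j" "j < j'"
    using assms(1,3-5) segment_seg_b_le by (auto simp: meeting_def multisegment_def i_def j'_def i'_def j_def)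
  obtain R' where R': "C = add_mset \<Delta> R'" using assms(2) by (metis mset_add)
  moreover have "\<Delta> \<noteq> \<Delta>'" using assms(4) by auto
  ultimately obtain R where R: "C = R + {#\<Delta>, \<Delta>'#}" using assms(3)
    by (metis add_mset_add_single add_mset_commute insert_noteq_member mset_add union_mset_add_mset_right)
  define C' where "C' = R + {#{i..j}, {i'..j'}#}"
  have op: "elem_op C' C"
    using le by (intro elem_opI[of i i' j j' _ R]) (auto simp: C'_def R D)
  have b: "image_mset seg_b C' = image_mset seg_b C" and e: "image_mset seg_e C' = image_mset seg_e C"
    using le by (simp_all add: C'_def R D add_mset_commute)
  have "meeting X \<longleftrightarrow> multisegment X \<and> (\<forall>x\<in>#image_mset seg_b X. \<forall>y\<in>#image_mset seg_e X. x \<le> y)" for X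
    by (simp add: meeting_def)
  moreover have "multisegment C'"
    using assms(1) le by (auto simp: C'_def R meeting_def multisegment_def)
  ultimately have "meeting C'" using assms(1) b e by metis
  then show ?thesis using op b e by blast
qed

lemma unnested_above:
  assumes "meeting C"
  obtains X where "C \<in> S X" "meeting X" "image_mset seg_b X = image_mset seg_b C"
    "image_mset seg_e X = image_mset seg_e C"
    "\<And>\<Delta> \<Delta>'. \<Delta> \<in># X \<Longrightarrow> \<Delta>' \<in># X \<Longrightarrow> seg_b \<Delta> < seg_b \<Delta>' \<Longrightarrow> seg_e \<Delta> \<le> seg_e \<Delta>'"
proof -
  define Q where "Q X \<longleftrightarrow> C \<in> S X \<and> meeting X \<and> image_mset seg_b X = image_mset seg_b C \<and>
    image_mset seg_e X = image_mset seg_e C" for X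
  have "Q C" using assms S_refl by (simp add: Q_def)
  then obtain X where X: "Q X" "\<And>Y. Q Y \<Longrightarrow> sum_squares X \<le> sum_squares Y"
    using ex_has_least_nat[of Q C sum_squares] by blast
  have "seg_e \<Delta> \<le> seg_e \<Delta>'" if D: "\<Delta> \<in># X" "\<Delta>' \<in># X" "seg_b \<Delta> < seg_b \<Delta>'" for \<Delta> \<Delta>'
  proof (rule ccontr)
    assume "\<not> ?thesis"
    then obtain Y where Y: "elem_op Y X" "meeting Y" "image_mset seg_b Y = image_mset seg_b X"
      "image_mset seg_e Y = image_mset seg_e X"
      using elem_op_above_nested[of X \<Delta> \<Delta>'] D X(1) by (auto simp: Q_def)
    have "X \<in> S Y" using Y(1) by (auto simp: S_def ms_le_def)
    then have "Q Y" using Y X(1) S_trans by (auto simp: Q_def)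
    then show False using X(2)[of Y] elem_op_sum_squares[OF Y(1)] by simp
  qed
  then show thesis using that X(1) by (auto simp: Q_def)
qed

text \<open>Without strictly nested segments, the lexicographic order of the pairs of coordinates sorts the
  beginnings and the ends simultaneously.\<close>

lemma unnested_eq_sorted_pairing:
  assumes "multisegment X"
    and "\<And>\<Delta> \<Delta>'. \<Delta> \<in># X \<Longrightarrow> \<Delta>' \<in># X \<Longrightarrow> seg_b \<Delta> < seg_b \<Delta>' \<Longrightarrow> seg_e \<Delta> \<le> seg_e \<Delta>'"
  shows "X = mset (map2 (\<lambda>b e. {b..e}) (sorted_list_of_multiset (image_mset seg_b X))
    (sorted_list_of_multiset (image_mset seg_e X)))"
proof -
  define xs where "xs = sorted_list_of_multiset (image_mset (\<lambda>\<Delta>. (seg_b \<Delta>, seg_e \<Delta>)) X)"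
  have mx: "mset xs = image_mset (\<lambda>\<Delta>. (seg_b \<Delta>, seg_e \<Delta>)) X" by (simp add: xs_def)
  have sx: "sorted xs" by (simp add: xs_def)
  have el: "\<exists>\<Delta>\<in>#X. p = (seg_b \<Delta>, seg_e \<Delta>)" if "p \<in> set xs" for p
    using that mx by (metis (no_types, lifting) imageE set_image_mset set_mset_mset)
  have "sorted_wrt (\<lambda>p q. fst p \<le> fst q \<and> snd p \<le> snd q) xs"
  proof (rule sorted_wrt_mono_rel[OF _ sx])
    fix p q assume pq: "p \<in> set xs" "q \<in> set xs" "p \<le> q"
    obtain \<Delta> \<Delta>' where D: "\<Delta> \<in># X" "p = (seg_b \<Delta>, seg_e \<Delta>)" "\<Delta>' \<in># X" "q = (seg_b \<Delta>', seg_e \<Delta>')"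
      using el pq by metis
    show "fst p \<le> fst q \<and> snd p \<le> snd q"
      using pq(3) assms(2)[OF D(1,3)] unfolding D by (auto simp: less_eq_prod_def)
  qed
  then have "sorted (map fst xs)" "sorted (map snd xs)"
    by (auto simp: sorted_map elim: sorted_wrt_mono_rel[rotated])
  moreover have "mset (map fst xs) = image_mset seg_b X" "mset (map snd xs) = image_mset seg_e X"
    by (simp_all add: mx image_mset.compositionality comp_def)
  ultimately have "map fst xs = sorted_list_of_multiset (image_mset seg_b X)"
    "map snd xs = sorted_list_of_multiset (image_mset seg_e X)"
    by (metis sorted_list_of_multiset_mset sorted_sort_id)+
  then have "mset (map2 (\<lambda>b e. {b..e}) (sorted_list_of_multiset (image_mset seg_b X))
    (sorted_list_of_multiset (image_mset seg_e X))) = image_mset (\<lambda>(b, e). {b..e}) (mset xs)"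
    by (metis mset_map zip_map_fst_snd)
  also have "\<dots> = image_mset (\<lambda>\<Delta>. {seg_b \<Delta>..seg_e \<Delta>}) X"
    by (simp add: mx image_mset.compositionality comp_def)
  also have "\<dots> = image_mset (\<lambda>\<Delta>. \<Delta>) X"
    using assms(1) by (intro image_mset_cong) (auto simp: multisegment_def segment_eq)
  finally show ?thesis by simp
qed

lemma sum_singletons: "finite I \<Longrightarrow> (\<Sum>i\<in>I. {#f i#}) = image_mset f (mset_set I)"
  by (induction I rule: finite_induct) auto

lemma mset_eq_image_positions:
  "mset xs = image_mset (\<lambda>i. xs ! (i - 1)) (mset_set {1..length xs})"
proof -
  have "mset_set {1..length xs} = image_mset Suc (mset_set {0..<length xs})"
    by (simp add: image_mset_mset_set atLeastLessThanSuc_atLeastAtMost)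
  then have "image_mset (\<lambda>i. xs ! (i - 1)) (mset_set {1..length xs}) = image_mset (\<lambda>i. xs ! i) (mset_set {0..<length xs})"
    by (simp only: image_mset.compositionality comp_def diff_Suc_1)
  also have "\<dots> = mset (map (\<lambda>i. xs ! i) [0..<length xs])" by simp
  finally show ?thesis by (simp add: map_nth)
qed

lemma length_sorted_list_of_multiset: "length (sorted_list_of_multiset X) = size X"
  by (metis mset_sorted_list_of_multiset size_mset)

text \<open>The segments \<open>D i\<close> pair the sorted beginnings with the sorted ends. Any \<open>A\<close> with these beginnings and
  ends is some \<open>a_perm N D w\<close>, and it lies below the sorted pairing by the previous lemmas.\<close>

lemma meeting_parabolic:
  assumes "meeting A"
  shows "\<exists>D w. Id_segments (size A) (J1_of A) (J2_of A) D \<and> w \<in> SN_J (size A) (J1_of A) (J2_of A) \<and>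
    a_perm (size A) D w = A \<and> parabolic_type (size A) (J1_of A) (J2_of A) A"
proof -
  define N where "N = size A"
  define k where "k = sorted_list_of_multiset (image_mset seg_b A)"
  define l where "l = sorted_list_of_multiset (image_mset seg_e A)"
  define D where "D i = {k ! (i - 1)..l ! (i - 1)}" for i
  have len: "length k = N" "length l = N"
    by (simp_all add: k_def l_def N_def length_sorted_list_of_multiset)
  have sorted: "sorted k" "sorted l" by (simp_all add: k_def l_def)
  have kl: "k ! m \<le> l ! n" if "m < N" "n < N" for m n
  proof -
    have "k ! m \<in># image_mset seg_b A" "l ! n \<in># image_mset seg_e A"
      using that len by (metis k_def nth_mem set_sorted_list_of_multiset, metis l_def nth_mem set_sorted_list_of_multiset)
    then show ?thesis using assms by (auto simp: meeting_def)
  qed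
  have D: "segment (D i)" "seg_b (D i) = k ! (i - 1)" "seg_e (D i) = l ! (i - 1)" if "i \<in> {1..N}" for i
    using kl[of "i - 1" "i - 1"] that by (auto simp: D_def)
  have J1: "J1_of A = {simple_transp i |i. i \<in> {1..<N} \<and> l ! (i - 1) = l ! i}"
    by (simp add: J1_of_def Let_def l_def N_def)
  have J2: "J2_of A = {simple_transp i |i. i \<in> {1..<N} \<and> k ! (i - 1) = k ! i}"
    by (simp add: J2_of_def Let_def k_def N_def)
  have Id: "Id_segments N (J1_of A) (J2_of A) D"
    unfolding Id_segments_def
  proof (intro conjI ballI impI)
    fix i assume i: "i \<in> {1..<N}"
    then have i': "i \<in> {1..N}" "Suc i \<in> {1..N}" by auto
    show "seg_e (D i) \<le> seg_e (D (Suc i))" "seg_b (D i) \<le> seg_b (D (Suc i))"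
      using i D[OF i'(1)] D[OF i'(2)] sorted len by (auto intro!: sorted_nth_mono)
    show "seg_e (D i) = seg_e (D (Suc i)) \<longleftrightarrow> simple_transp i \<in> J1_of A"
      "seg_b (D i) = seg_b (D (Suc i)) \<longleftrightarrow> simple_transp i \<in> J2_of A"
      using i D[OF i'(1)] D[OF i'(2)] by (auto simp: J1 J2 simple_transp_inject)
  next
    assume "1 \<le> N"
    then show "seg_b (D N) \<le> seg_e (D 1)" using D[of N] D[of 1] kl[of "N - 1" 0] by auto
  qed (use D in auto)

  obtain X where X: "A \<in> S X" "meeting X" "image_mset seg_b X = image_mset seg_b A"
    "image_mset seg_e X = image_mset seg_e A"
    "\<And>\<Delta> \<Delta>'. \<Delta> \<in># X \<Longrightarrow> \<Delta>' \<in># X \<Longrightarrow> seg_b \<Delta> < seg_b \<Delta>' \<Longrightarrow> seg_e \<Delta> \<le> seg_e \<Delta>'"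
    using unnested_above[OF assms] by metis
  have "X = mset (map2 (\<lambda>b e. {b..e}) k l)"
    using unnested_eq_sorted_pairing[of X] X by (simp add: k_def l_def meeting_def)
  also have "\<dots> = image_mset D (mset_set {1..N})"
    unfolding mset_eq_image_positions by (auto simp: len D_def intro!: image_mset_cong)
  also have "\<dots> = a_Id N D" by (simp add: a_Id_def sum_singletons)
  finally have par: "parabolic_type N (J1_of A) (J2_of A) A"
    using X(1) Id by (auto simp: parabolic_type_def)

  obtain ys where ys: "mset ys = A" by (metis ex_mset)
  define xs where "xs = sort_key seg_b ys"
  have xs: "mset xs = A" "sorted (map seg_b xs)" by (simp_all add: xs_def ys)
  have lx: "length xs = N" by (simp add: N_def xs(1)[symmetric])
  have kx: "map seg_b xs = k"
    unfolding k_def xs(1)[symmetric] mset_map[symmetric] sorted_list_of_multiset_mset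
    using xs(2) by (simp add: sorted_sort_id)
  have ml: "mset l = image_mset seg_e A" by (simp add: l_def)
  have "image_mset (\<lambda>i. seg_e (xs ! (i - 1))) (mset_set {1..N}) = image_mset seg_e (mset xs)"
    unfolding mset_eq_image_positions lx by (simp add: image_mset.compositionality comp_def)
  also have "\<dots> = image_mset (\<lambda>i. l ! (i - 1)) (mset_set {1..N})"
    using mset_eq_image_positions[of l] by (simp add: len xs(1) ml)
  finally have "image_mset (\<lambda>i. seg_e (xs ! (i - 1))) (mset_set {1..N})
      = image_mset (\<lambda>i. l ! (i - 1)) (mset_set {1..N})" .
  then obtain p where p: "p permutes {1..N}" "\<forall>i\<in>{1..N}. seg_e (xs ! (i - 1)) = l ! (p i - 1)"
    by (rule image_mset_eq_implies_permutes[OF finite_atLeastAtMost])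
  have "a_perm N D p = image_mset (\<lambda>i. {seg_b (D i)..seg_e (D (p i))}) (mset_set {1..N})"
    by (simp add: a_perm_def sum_singletons)
  also have "\<dots> = image_mset (\<lambda>i. xs ! (i - 1)) (mset_set {1..N})"
  proof (rule image_mset_cong)
    fix i assume "i \<in># mset_set {1..N}"
    then have i: "i \<in> {1..N}" by simp
    then have pi: "p i \<in> {1..N}" using permutes_in_image[OF p(1)] by blast
    have "i - 1 < length xs" using i lx by auto
    then have "xs ! (i - 1) \<in># A" "k ! (i - 1) = seg_b (xs ! (i - 1))"
      using xs(1) kx by auto
    moreover have "{seg_b (xs ! (i - 1))..seg_e (xs ! (i - 1))} = xs ! (i - 1)"
      using calculation(1) assms segment_eq by (auto simp: meeting_def multisegment_def)
    ultimately show "{seg_b (D i)..seg_e (D (p i))} = xs ! (i - 1)"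
      using bspec[OF p(2) i] D[OF i] D[OF pi] by simp
  qed
  also have "\<dots> = A" using mset_eq_image_positions[of xs] by (simp add: lx xs(1))
  finally have pA: "a_perm N D p = A" .

  have "\<exists>w. w \<in> SN_J N (J1_of A) (J2_of A) \<and> a_perm N D w = A"
  proof (rule minimal_length_in_SN_J[where P = "\<lambda>w. a_perm N D w = A", OF p(1) pA])
    show "J1_of A \<subseteq> simple_transp ` {1..<N}" "J2_of A \<subseteq> simple_transp ` {1..<N}"
      unfolding J1 J2 by blast+
  next
    fix v s assume v: "v permutes {1..N}" "s \<in> J1_of A" "a_perm N D v = A"
    then obtain i where i: "i \<in> {1..<N}" "l ! (i - 1) = l ! i" "s = simple_transp i" by (auto simp: J1)
    have "seg_e (D (s x)) = seg_e (D x)" for x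
      using i D(3)[of i] D(3)[of "Suc i"] by (auto simp: simple_transp_def transpose_def)
    then show "a_perm N D (s \<circ> v) = A" using v(3) by (simp add: a_perm_def)
  next
    fix v s assume v: "v permutes {1..N}" "s \<in> J2_of A" "a_perm N D v = A"
    then obtain i where i: "i \<in> {1..<N}" "k ! (i - 1) = k ! i" "s = simple_transp i" by (auto simp: J2)
    have "seg_b (D (s x)) = seg_b (D x)" for x
      using i D(2)[of i] D(2)[of "Suc i"] by (auto simp: simple_transp_def transpose_def)
    moreover have "s permutes {1..N}" using i by (simp add: simple_transp_def permutes_swap_id)
    then have "a_perm N D v = (\<Sum>x\<in>{1..N}. {#{seg_b (D (s x))..seg_e (D (v (s x)))}#})"
      unfolding a_perm_def by (subst sum.permute) (simp_all add: comp_def)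
    ultimately show "a_perm N D (v \<circ> s) = A" using v(3) by (simp add: a_perm_def)
  qed
  then show ?thesis using Id par unfolding N_def by blast
qed


section \<open>Reduction to the parabolic type\<close>

text \<open>Moving all ends up by a large \<open>M\<close> makes every beginning at most every end, and preserves all
  coincidences among the beginnings and among the ends.\<close>

lemma meeting_shift:
  assumes "multisegment a" "\<And>\<Delta> \<Delta>'. \<Delta> \<in># a \<Longrightarrow> \<Delta>' \<in># a \<Longrightarrow> seg_b \<Delta> \<le> seg_e \<Delta>' + M" "0 \<le> M"
  defines "A \<equiv> image_mset (\<lambda>\<Delta>. {seg_b \<Delta>..seg_e \<Delta> + M}) a"
  shows "meeting A" "image_mset seg_b A = image_mset seg_b a"
    "image_mset seg_e A = image_mset (\<lambda>e. e + M) (image_mset seg_e a)"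
    "J1_of A = J1_of a" "J2_of A = J2_of a"
proof -
  have le: "seg_b \<Delta> \<le> seg_e \<Delta> + M" if "\<Delta> \<in># a" for \<Delta>
    using assms(2) that by blast
  show b: "image_mset seg_b A = image_mset seg_b a"
    and e: "image_mset seg_e A = image_mset (\<lambda>e. e + M) (image_mset seg_e a)"
    using le by (auto simp: A_def image_mset.compositionality intro!: image_mset_cong)
  show "meeting A" using assms(2) by (auto simp: A_def meeting_def multisegment_def)
  show "J2_of A = J2_of a" unfolding J2_of_def b by (simp add: A_def)
  define l where "l = sorted_list_of_multiset (image_mset seg_e a)"
  have "sorted (map (\<lambda>e. e + M) l)" by (auto simp: l_def sorted_map sorted_wrt_iff_nth_less intro: sorted_nth_mono)
  moreover have "mset (map (\<lambda>e. e + M) l) = image_mset seg_e A" by (simp add: l_def e)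
  ultimately have "sorted_list_of_multiset (image_mset seg_e A) = map (\<lambda>e. e + M) l"
    by (metis sorted_list_of_multiset_mset sorted_sort_id)
  moreover have "length l = size a" by (simp add: l_def length_sorted_list_of_multiset)
  moreover have "size A = size a" by (simp add: A_def)
  ultimately show "J1_of A = J1_of a"
    unfolding J1_of_def l_def[symmetric] Let_def by (intro Collect_cong) auto
qed

lemma relabel_shift:
  assumes "multisegment a" "0 \<le> M" "\<And>\<Delta>. \<Delta> \<in># a \<Longrightarrow> \<tau> (seg_e \<Delta> + M) = seg_e \<Delta>"
  defines "A \<equiv> image_mset (\<lambda>\<Delta>. {seg_b \<Delta>..seg_e \<Delta> + M}) a"
  shows "relabel \<tau> A = a" "fits \<tau> A"
proof -
  have "relabel \<tau> A = relabel (\<lambda>e. e) a"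
    unfolding relabel_def A_def image_mset.compositionality comp_def
    using assms(1,2,3) segment_seg_b_le
    by (intro arg_cong[where f = discard_empty] image_mset_cong) (force simp: multisegment_def)
  then show "relabel \<tau> A = a" using relabel_id[OF assms(1)] by simp
  show "fits \<tau> A" using assms(1,2,3) segment_seg_b_le
    by (fastforce simp: fits_def A_def multisegment_def)
qed

theorem proposition6p3p6:
  fixes a :: "int set multiset" and N :: nat and J1 J2 :: "(nat \<Rightarrow> nat) set"
  assumes "multisegment a" and "size a = N"
    and "J1 = J1_of a" and "J2 = J2_of a"
  shows "\<exists>D w ks. Id_segments N J1 J2 D \<and> w \<in> SN_J N J1 J2 \<and>
           parabolic_type N J1 J2 (a_perm N D w) \<and>
           poset_iso (S a) (S_subs (a_perm N D w) (rev ks)) \<and>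
           (\<exists>a' \<in> S (a_perm N D w).
              S_subs (a_perm N D w) (rev ks) = {c \<in> S (a_perm N D w). ms_le a' c})"
proof -
  have "\<exists>B. \<forall>\<Delta>\<in>#a. \<bar>seg_b \<Delta>\<bar> \<le> int B \<and> \<bar>seg_e \<Delta>\<bar> \<le> int B" for a :: "int set multiset"
  proof (induction a)
    case (add \<Delta> a)
    then obtain B where "\<forall>\<Delta>\<in>#a. \<bar>seg_b \<Delta>\<bar> \<le> int B \<and> \<bar>seg_e \<Delta>\<bar> \<le> int B" by blast
    then show ?case by (intro exI[of _ "B + nat \<bar>seg_b \<Delta>\<bar> + nat \<bar>seg_e \<Delta>\<bar>"]) force
  qed simp
  then obtain B where B: "\<And>\<Delta>. \<Delta> \<in># a \<Longrightarrow> \<bar>seg_b \<Delta>\<bar> \<le> int B \<and> \<bar>seg_e \<Delta>\<bar> \<le> int B" by metis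
  \<comment> \<open>All coordinates of \<open>a\<close> lie in \<open>[-B, B]\<close>, so that a shift by \<open>2 * B\<close> suffices.\<close>
  define M where "M = 2 * B"
  define A where "A = image_mset (\<lambda>\<Delta>. {seg_b \<Delta>..seg_e \<Delta> + int M}) a"
  have "seg_b \<Delta> \<le> seg_e \<Delta>' + int M" if "\<Delta> \<in># a" "\<Delta>' \<in># a" for \<Delta> \<Delta>'
    using B[OF that(1)] B[OF that(2)] by (simp add: M_def abs_le_iff)
  from meeting_shift[OF assms(1) this] have A: "meeting A" "J1_of A = J1" "J2_of A = J2"
    and ends: "image_mset seg_e A = image_mset (\<lambda>e. e + int M) (image_mset seg_e a)"
    by (simp_all add: A_def assms(3,4))
  have "size A = N" by (simp add: A_def assms(2))
  with meeting_parabolic[OF A(1)] A obtain D w where Dw: "Id_segments N J1 J2 D" "w \<in> SN_J N J1 J2"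
    "a_perm N D w = A" "parabolic_type N J1 J2 A" by auto
  define E where "E = seg_e ` set_mset A"
  \<comment> \<open>Each of the \<open>M\<close> rounds moves all ends down by one.\<close>
  define ls where "ls = concat (replicate M [- int B..int B + int M])"
  define \<tau> where "\<tau> = fold lower ls"
  have "E = (\<lambda>e. e + int M) ` seg_e ` set_mset a" using arg_cong[OF ends, of set_mset] by (simp add: E_def)
  moreover from this have "E \<subseteq> {- int B + int M..int B + int M}" using B by force
  from fold_lower_rounds[OF this] have cf: "collision_free E ls" and "\<And>e. e \<in> E \<Longrightarrow> \<tau> e = e - int M"
    by (auto simp: ls_def \<tau>_def)
  ultimately have "\<tau> (seg_e \<Delta> + int M) = seg_e \<Delta>" if "\<Delta> \<in># a" for \<Delta>
    using that by simp
  from relabel_shift[OF assms(1) _ this, folded A_def] have rel: "relabel \<tau> A = a" and fit: "fits \<tau> A"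
    by simp_all
  have mono: "strict_mono_on E \<tau>"
    using collision_free_take(1)[OF cf, of "length ls"] by (simp add: \<tau>_def)
  have sub: "S_subs A ls = {C \<in> S A. fits \<tau> C}"
    using S_subs_eq[OF A(1)] cf fit by (simp add: E_def \<tau>_def)
  have "seg_e ` set_mset A \<subseteq> E" by (simp add: E_def)
  with relabel_poset_iso[OF A(1) mono _ fit] fits_eq_above[OF A(1) mono _ fit]
  have "poset_iso (S a) (S_subs A ls)" "\<exists>a'\<in>S A. S_subs A ls = {c \<in> S A. ms_le a' c}"
    by (simp_all add: sub rel)
  then show ?thesis
    using Dw by (intro exI[of _ D] exI[of _ w] exI[of _ "rev ls"]) simp
qed

end
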